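(* Let $M$ be a quasi-Hessian manifold with quasi-Hessian metric $h$ and canonical cubic tensor $C$. Then the canonical divergence $\mathcal{D}_M$ is a weak contrast function, and it reproduces $h$ and $C$: for all vector fields $X,Y,Z$ on $M$, $$h(X,Y)=-\mathcal{D}_M[X|Y],\qquad C(X,Y,Z)=\mathcal{D}_M[XY|Z]-\mathcal{D}_M[Z|XY].$$
   Context: All manifolds and maps are $C^\infty$. $\mathbb{R}^{2n+1}$ has coordinates $(\boldsymbol{x},\boldsymbol{p},z)$ with $\boldsymbol{x},\boldsymbol{p}\in\mathbb{R}^n$ (column vectors), $z\in\mathbb{R}$, contact form $\theta=dz-\sum_i p_i\,dx_i$, and $z':=\boldsymbol{p}^T\boldsymbol{x}-z$. A Legendre submanifold is an $n$-dimensional submanifold $L$ with $\theta|_{TL}=0$. Affine Legendre equivalence: an affine map $\mathcal{L}_F(\boldsymbol{x},\boldsymbol{p},z)=(A\boldsymbol{x}+\boldsymbol{b},\,A'\boldsymbol{p}+\boldsymbol{b}',\,z+\boldsymbol{c}^T\boldsymbol{x}+d)$ with $A\in GL_n(\mathbb{R})$, $A'=(A^T)^{-1}$, $\boldsymbol{b}'=A'\boldsymbol{c}$, $\boldsymbol{b},\boldsymbol{c}\in\mathbb{R}^n$, $d\in\mathbb{R}$; it preserves $\theta$. Coherent tangent bundles of $L$: $E=\{(q,w)\in L\times(\mathbb{R}^n_{\boldsymbol{x}}\times\mathbb{R}_z): dz(w)-\boldsymbol{p}(q)^Td\boldsymbol{x}(w)=0\}$ and $E'=\{(q,w)\in L\times(\mathbb{R}^n_{\boldsymbol{p}}\times\mathbb{R}_{z'}):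 dz'(w)-\boldsymbol{x}(q)^Td\boldsymbol{p}(w)=0\}$, with bundle maps $\Phi:TL\to E$, $\Phi':TL\to E'$ the differentials of $q\mapsto(\boldsymbol{x}(q),z(q))$ and $q\mapsto(\boldsymbol{p}(q),z'(q))$, and with the flat connections $\nabla^E,\nabla^{E'}$ for which the frames $s_i=\frac{\partial}{\partial x_i}+p_i\frac{\partial}{\partial z}$ of $E$ and $s_i^*=\frac{\partial}{\partial p_i}+x_i\frac{\partial}{\partial z'}$ of $E'$ are flat. On $E\oplus E'$ there is the pseudo-Riemannian metric $\tau$ of type $(n,n)$ with $\tau(s_i,s_j)=\tau(s_i^*,s_j^* )=0$, $\tau(s_i,s_j^* )=\frac12\delta_{ij}$. The quasi-Hessian metric is the (possibly degenerate) symmetric $(0,2)$-tensor $h(Y,Z)=\tau(\Phi(Y)\oplus\Phi'(Y),\Phi(Z)\oplus\Phi'(Z))$ on $L$. Quasi-Hessian manifold: an $n$-dimensional Hausdorff manifold $M$ obtained by gluing countably many Legendre submanifolds $L_\alpha\subset\mathbb{R}^{2n+1}$ (local models) along open subsets $L_{\alpha\beta}\subset L_\alpha$ by diffeomorphisms $\mathcal{L}_\alpha^\beta:L_{\alpha\beta}\to L_{\beta\alpha}$ which on each connected component of $L_{\alpha\beta}$ are given by an affine Legendre equivalence of $\mathbb{R}^{2n+1}$ and satisfy $\mathcal{L}_\alpha^\gamma=\mathcal{L}_\beta^\gamma\circ\mathcal{L}_\alpha^\beta$ on $L_{\alpha\beta}\cap L_{\alpha\gamma}$. The data $h,\tau,(E,\nabla^E,\Phi),(E',\nabla^{E'},\Phi')$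 of the local models are compatible with these gluings and give corresponding data on $M$. Canonical cubic tensor: for vector fields $X,Y,Z$ on $M$ put $\eta=\Phi(Y),\ \zeta=\Phi(Z),\ \eta'=\Phi'(Y),\ \zeta'=\Phi'(Z)$ and $$C(X,Y,Z)=\tau(\eta,\nabla^{E'}_X\zeta')+\tau(\zeta,\nabla^{E'}_X\eta')-\tau(\nabla^E_X\eta,\zeta')-\tau(\nabla^E_X\zeta,\eta'),$$ where $\tau(\eta,\zeta'):=\tau(\eta\oplus0,0\oplus\zeta')$. Canonical divergence: for a Legendre submanifold $L$, $\mathcal{D}_L(p,q)=z(p)+z'(q)-\boldsymbol{x}(p)^T\boldsymbol{p}(q)$; it is invariant under affine Legendre equivalence. For a quasi-Hessian manifold, $\mathcal{D}_M(p,q):=\mathcal{D}_{L_\alpha}(p,q)$ for $p,q$ in a common local model $L_\alpha$, which defines a function on an open neighborhood of the diagonal $\varDelta_M\subset M\times M$ (only its germ along the diagonal matters here). Bracket notation: for $\rho$ defined on an open neighborhood of $\varDelta_M$ and vector fields $X_i,Y_j$, $\rho[X_1\cdots X_k|Y_1\cdots Y_l]:M\to\mathbb{R}$ is $r\mapsto (X_1)_p\cdots(X_k)_p(Y_1)_q\cdots(Y_l)_q(\rho(p,q))|_{p=q=r}$, the $X_i$ acting on the first and the $Y_j$ on the second variable; "$-$" in a slot means no differentiation in that variable. $\rho$ is a weak contrast function if $\rho[-|-]=0$ (i.e. $\rho(p,p)=0$) and $\rho[X|-]=\rho[-|X]=0$ for all vector fields $X$. *)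

theory Defs
  imports "HOL-Analysis.Analysis"
begin

section \<open>Smooth maps and diffeomorphisms between subsets of Euclidean spaces\<close>

text \<open>For an open set \<open>S\<close>, \<open>Ck_on k f S\<close> says that \<open>f\<close> is of class \<open>C\<^sup>k\<close> on \<open>S\<close>
  (all directional derivatives of a differentiable \<open>f\<close> are of class \<open>C\<^sup>k\<^sup>-\<^sup>1\<close>).\<close>

primrec Ck_on :: "nat \<Rightarrow> ('a::euclidean_space \<Rightarrow> 'b::real_normed_vector) \<Rightarrow> 'a set \<Rightarrow> bool" where
  "Ck_on 0 f S \<longleftrightarrow> continuous_on S f"
| "Ck_on (Suc k) f S \<longleftrightarrow>
     (\<forall>x\<in>S. f differentiable (at x)) \<and> (\<forall>v. Ck_on k (\<lambda>x. frechet_derivative f (at x) v) S)"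

text \<open>Smoothness on an arbitrary subset: local smooth extendability to the ambient space.\<close>

definition smooth_on :: "'a::euclidean_space set \<Rightarrow> ('a \<Rightarrow> 'b::real_normed_vector) \<Rightarrow> bool" where
  "smooth_on S f \<longleftrightarrow>
     (\<forall>q\<in>S. \<exists>U g. open U \<and> q \<in> U \<and> (\<forall>k. Ck_on k g U) \<and> (\<forall>x\<in>U \<inter> S. g x = f x))"

definition diffeomorphism ::
  "'a::euclidean_space set \<Rightarrow> 'b::euclidean_space set \<Rightarrow> ('a \<Rightarrow> 'b) \<Rightarrow> bool" where
  "diffeomorphism S T f \<longleftrightarrow> bij_betw f S T \<and> smooth_on S f \<and> smooth_on T (inv_into S f)"

definition tangent_space :: "'a::euclidean_space set \<Rightarrow> 'a \<Rightarrow> 'a set" where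
  "tangent_space L q =
     {v. \<exists>\<epsilon>>0. \<exists>\<gamma>. smooth_on {-\<epsilon><..<\<epsilon>} \<gamma> \<and> \<gamma> ` {-\<epsilon><..<\<epsilon>} \<subseteq> L \<and> \<gamma> 0 = q \<and>
        (\<gamma> has_vector_derivative v) (at (0::real))}"

text \<open>The differential at \<open>q\<close> of a map \<open>f\<close> defined on a submanifold \<open>L\<close>. Relative derivatives
  are not unique in directions transversal to \<open>L\<close>, but they are on \<open>tangent_space L q\<close>; it is only
  ever applied to tangent vectors.\<close>

definition dif :: "'a::euclidean_space set \<Rightarrow> ('a \<Rightarrow> 'b::real_normed_vector) \<Rightarrow> 'a \<Rightarrow> 'a \<Rightarrow> 'b" where
  "dif L f q v = frechet_derivative f (at q within L) v"


section \<open>Legendre submanifolds and affine Legendre equivalences\<close>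

text \<open>The dimension \<open>n\<close> is \<open>CARD('n)\<close>; points of \<open>\<real>\<^sup>2\<^sup>n\<^sup>+\<^sup>1\<close> are triples \<open>(x, p, z)\<close>.\<close>

type_synonym 'n contact = "(real^'n) \<times> (real^'n) \<times> real"

definition xc :: "'n::finite contact \<Rightarrow> real^'n" where "xc q = fst q"
definition pc :: "'n::finite contact \<Rightarrow> real^'n" where "pc q = fst (snd q)"
definition zc :: "'n::finite contact \<Rightarrow> real" where "zc q = snd (snd q)"

definition zc' :: "'n::finite contact \<Rightarrow> real" where
  "zc' q = pc q \<bullet> xc q - zc q"

definition contact_form :: "'n::finite contact \<Rightarrow> 'n contact \<Rightarrow> real" where
  "contact_form q v = zc v - (\<Sum>i\<in>UNIV. pc q $ i * xc v $ i)"

definition n_submanifold :: "'n::finite contact set \<Rightarrow> bool" where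
  "n_submanifold L \<longleftrightarrow>
     (\<forall>q\<in>L. \<exists>U (V :: (real^'n) set) \<phi>.
        open U \<and> q \<in> U \<and> open V \<and> diffeomorphism V (L \<inter> U) \<phi>)"

definition legendre_submanifold :: "'n::finite contact set \<Rightarrow> bool" where
  "legendre_submanifold L \<longleftrightarrow>
     n_submanifold L \<and> (\<forall>q\<in>L. \<forall>v\<in>tangent_space L q. contact_form q v = 0)"

definition affine_legendre_equivalence :: "('n::finite contact \<Rightarrow> 'n contact) \<Rightarrow> bool" where
  "affine_legendre_equivalence F \<longleftrightarrow>
     (\<exists>(A :: real^'n^'n) A' b b' c d.
        invertible A \<and> A' = matrix_inv (transpose A) \<and> b' = A' *v c \<and>
        F = (\<lambda>(x, p, z). (A *v x + b, A' *v p + b', z + c \<bullet> x + d)))"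


section \<open>Coherent tangent bundles and the tensors of a Legendre submanifold\<close>

text \<open>The fibres over \<open>q\<close> of \<open>E \<subseteq> L \<times> (\<real>\<^sup>n\<^sub>x \<times> \<real>\<^sub>z)\<close> and of
  \<open>E' \<subseteq> L \<times> (\<real>\<^sup>n\<^sub>p \<times> \<real>\<^sub>z\<^sub>')\<close>.\<close>

definition E_fibre :: "'n::finite contact \<Rightarrow> ((real^'n) \<times> real) set" where
  "E_fibre q = {w. snd w - pc q \<bullet> fst w = 0}"

definition E'_fibre :: "'n::finite contact \<Rightarrow> ((real^'n) \<times> real) set" where
  "E'_fibre q = {w. snd w - xc q \<bullet> fst w = 0}"

definition Phi :: "'n::finite contact \<Rightarrow> 'n contact \<Rightarrow> (real^'n) \<times> real" where
  "Phi q v = frechet_derivative (\<lambda>r. (xc r, zc r)) (at q) v"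

definition Phi' :: "'n::finite contact \<Rightarrow> 'n contact \<Rightarrow> (real^'n) \<times> real" where
  "Phi' q v = frechet_derivative (\<lambda>r. (pc r, zc' r)) (at q) v"

definition frame_E :: "'n::finite contact \<Rightarrow> 'n \<Rightarrow> (real^'n) \<times> real" where
  "frame_E q i = (axis i 1, pc q $ i)"

definition frame_E' :: "'n::finite contact \<Rightarrow> 'n \<Rightarrow> (real^'n) \<times> real" where
  "frame_E' q i = (axis i 1, xc q $ i)"

definition frame_coeff :: "('n::finite \<Rightarrow> (real^'n) \<times> real) \<Rightarrow> (real^'n) \<times> real \<Rightarrow> real^'n" where
  "frame_coeff s w = (THE c. w = (\<Sum>i\<in>UNIV. c $ i *\<^sub>R s i))"

lemma frame_sum:
  fixes c a :: "real^'n::finite"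
  shows "(\<Sum>i\<in>UNIV. c $ i *\<^sub>R (axis i 1 :: real^'n, a $ i)) = (c, a \<bullet> c)"
proof -
  have "(\<Sum>i\<in>UNIV. c $ i *\<^sub>R (axis i 1 :: real^'n)) = c"
    using basis_expansion[of c] by (simp add: scalar_mult_eq_scaleR)
  moreover have "(\<Sum>i\<in>UNIV. c $ i * a $ i) = a \<bullet> c"
    by (simp add: inner_vec_def mult.commute)
  ultimately show ?thesis
    by (simp add: prod_eq_iff fst_sum snd_sum)
qed

lemma frame_coeff_E:
  assumes "w \<in> E_fibre q"
  shows "frame_coeff (frame_E q) w = fst w"
  unfolding frame_coeff_def frame_E_def frame_sum
  by (rule the_equality) (use assms in \<open>auto simp: E_fibre_def prod_eq_iff\<close>)

lemma frame_coeff_E':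
  assumes "w \<in> E'_fibre q"
  shows "frame_coeff (frame_E' q) w = fst w"
  unfolding frame_coeff_def frame_E'_def frame_sum
  by (rule the_equality) (use assms in \<open>auto simp: E'_fibre_def prod_eq_iff\<close>)

lemma coord_derivs:
  fixes q :: "'n::finite contact"
  shows "(xc has_derivative xc) (at q)" "(pc has_derivative pc) (at q)" "(zc has_derivative zc) (at q)"
proof -
  have "bounded_linear (\<lambda>q :: 'n contact. fst q)"
    "bounded_linear (\<lambda>q :: 'n contact. fst (snd q))"
    "bounded_linear (\<lambda>q :: 'n contact. snd (snd q))"
    by (rule bounded_linear_fst bounded_linear_compose[OF bounded_linear_fst bounded_linear_snd]
          bounded_linear_compose[OF bounded_linear_snd bounded_linear_snd])+
  then show "(xc has_derivative xc) (at q)" "(pc has_derivative pc) (at q)"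
    "(zc has_derivative zc) (at q)"
    unfolding xc_def[abs_def] pc_def[abs_def] zc_def[abs_def]
    by (simp_all add: bounded_linear_imp_has_derivative)
qed

lemma Phi_eq: "Phi q v = (xc v, zc v)"
proof -
  have "((\<lambda>r. (xc r, zc r)) has_derivative (\<lambda>r. (xc r, zc r))) (at q)"
    by (intro has_derivative_Pair coord_derivs)
  from fun_cong[OF frechet_derivative_at[OF this], of v] show ?thesis
    unfolding Phi_def by simp
qed

lemma Phi'_eq: "Phi' q v = (pc v, pc q \<bullet> xc v + pc v \<bullet> xc q - zc v)"
proof -
  have "((\<lambda>r. (pc r, pc r \<bullet> xc r - zc r)) has_derivative
          (\<lambda>v. (pc v, pc q \<bullet> xc v + pc v \<bullet> xc q - zc v))) (at q)"
    by (intro has_derivative_Pair has_derivative_diff has_derivative_inner coord_derivs)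
  from fun_cong[OF frechet_derivative_at[OF this], of v] show ?thesis
    unfolding Phi'_def zc'_def by simp
qed

lemma Phi_in_fibres:
  assumes "legendre_submanifold L" "q \<in> L" "v \<in> tangent_space L q"
  shows "Phi q v \<in> E_fibre q" "Phi' q v \<in> E'_fibre q"
proof -
  have "zc v = pc q \<bullet> xc v"
    using assms by (simp add: legendre_submanifold_def contact_form_def inner_vec_def)
  then show "Phi q v \<in> E_fibre q" "Phi' q v \<in> E'_fibre q"
    by (simp_all add: Phi_eq Phi'_eq E_fibre_def E'_fibre_def inner_commute)
qed

text \<open>The connection over \<open>L\<close> for which the frame \<open>s\<close> is flat:
  \<open>\<nabla>\<^sub>X (\<Sum>\<^sub>i f\<^sub>i s\<^sub>i) = \<Sum>\<^sub>i (X f\<^sub>i) s\<^sub>i\<close>.\<close>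

definition flat_connection ::
  "('n::finite contact \<Rightarrow> 'n \<Rightarrow> (real^'n) \<times> real) \<Rightarrow> 'n contact set \<Rightarrow> ('n contact \<Rightarrow> 'n contact) \<Rightarrow>
    ('n contact \<Rightarrow> (real^'n) \<times> real) \<Rightarrow> 'n contact \<Rightarrow> (real^'n) \<times> real" where
  "flat_connection s L X \<eta> q =
     (\<Sum>i\<in>UNIV. dif L (\<lambda>r. frame_coeff (s r) (\<eta> r) $ i) q (X q) *\<^sub>R s q i)"

abbreviation nabla_E where "nabla_E \<equiv> flat_connection frame_E"
abbreviation nabla_E' where "nabla_E' \<equiv> flat_connection frame_E'"

text \<open>The metric \<open>\<tau>\<close> on the fibre \<open>E\<^sub>q \<oplus> E'\<^sub>q\<close>: the symmetric bilinear form with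
  \<open>\<tau>(s\<^sub>i, s\<^sub>j) = \<tau>(s\<^sub>i\<^sup>*, s\<^sub>j\<^sup>*) = 0\<close> and \<open>\<tau>(s\<^sub>i, s\<^sub>j\<^sup>*) = \<delta>\<^sub>i\<^sub>j / 2\<close>.\<close>

definition tau ::
  "'n::finite contact \<Rightarrow> ((real^'n) \<times> real) \<times> ((real^'n) \<times> real) \<Rightarrow>
    ((real^'n) \<times> real) \<times> ((real^'n) \<times> real) \<Rightarrow> real" where
  "tau q u v =
     (\<Sum>i\<in>UNIV. \<Sum>j\<in>UNIV.
        (frame_coeff (frame_E q) (fst u) $ i * frame_coeff (frame_E' q) (snd v) $ j +
         frame_coeff (frame_E q) (fst v) $ i * frame_coeff (frame_E' q) (snd u) $ j)
        * (if i = j then 1/2 else 0))"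

definition tau_mix :: "'n::finite contact \<Rightarrow> (real^'n) \<times> real \<Rightarrow> (real^'n) \<times> real \<Rightarrow> real" where
  "tau_mix q \<eta> \<zeta>' = tau q (\<eta>, 0) (0, \<zeta>')"

definition local_metric :: "'n::finite contact \<Rightarrow> 'n contact \<Rightarrow> 'n contact \<Rightarrow> real" where
  "local_metric q v w = tau q (Phi q v, Phi' q v) (Phi q w, Phi' q w)"

definition local_cubic ::
  "'n::finite contact set \<Rightarrow> ('n contact \<Rightarrow> 'n contact) \<Rightarrow> ('n contact \<Rightarrow> 'n contact) \<Rightarrow>
    ('n contact \<Rightarrow> 'n contact) \<Rightarrow> 'n contact \<Rightarrow> real" where
  "local_cubic L X Y Z q =
     (let \<eta> = (\<lambda>r. Phi r (Y r)); \<zeta> = (\<lambda>r. Phi r (Z r));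
          \<eta>' = (\<lambda>r. Phi' r (Y r)); \<zeta>' = (\<lambda>r. Phi' r (Z r))
      in tau_mix q (\<eta> q) (nabla_E' L X \<zeta>' q) + tau_mix q (\<zeta> q) (nabla_E' L X \<eta>' q)
         - tau_mix q (nabla_E L X \<eta> q) (\<zeta>' q) - tau_mix q (nabla_E L X \<zeta> q) (\<eta>' q))"

definition local_divergence :: "'n::finite contact \<Rightarrow> 'n contact \<Rightarrow> real" where
  "local_divergence p q = zc p + zc' q - xc p \<bullet> pc q"


section \<open>Quasi-Hessian manifolds\<close>

text \<open>Local models \<open>L\<^sub>\<alpha>\<close>, overlaps \<open>L\<^sub>\<alpha>\<^sub>\<beta> \<subseteq> L\<^sub>\<alpha>\<close>, gluing maps
  \<open>L\<^sub>\<alpha>\<^sub>\<beta> \<rightarrow> L\<^sub>\<beta>\<^sub>\<alpha>\<close>, the glued space, and the canonical maps of the local models into it.\<close>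

record ('i, 'n, 'm) gluing =
  indices :: "'i set"
  model :: "'i \<Rightarrow> 'n contact set"
  overlap :: "'i \<Rightarrow> 'i \<Rightarrow> 'n contact set"
  glue :: "'i \<Rightarrow> 'i \<Rightarrow> 'n contact \<Rightarrow> 'n contact"
  glued :: "'m topology"
  incl :: "'i \<Rightarrow> 'n contact \<Rightarrow> 'm"

text \<open>The last two conditions say that the glued space is the quotient of the disjoint union of
  the local models by the identifications \<open>(\<alpha>, p) \<sim> (\<beta>, glue \<alpha> \<beta> p)\<close>, \<open>p \<in> L\<^sub>\<alpha>\<^sub>\<beta>\<close>.
  In particular (case \<open>\<alpha> = \<beta>\<close>) \<open>L\<^sub>\<alpha>\<^sub>\<alpha> = L\<^sub>\<alpha>\<close> is glued to itself by the identity.\<close>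

definition quasi_hessian_manifold :: "('i, 'n::finite, 'm) gluing \<Rightarrow> bool" where
  "quasi_hessian_manifold Q \<longleftrightarrow>
     countable (indices Q) \<and>
     (\<forall>\<alpha>\<in>indices Q. legendre_submanifold (model Q \<alpha>)) \<and>
     (\<forall>\<alpha>\<in>indices Q. \<forall>\<beta>\<in>indices Q.
        openin (top_of_set (model Q \<alpha>)) (overlap Q \<alpha> \<beta>) \<and>
        diffeomorphism (overlap Q \<alpha> \<beta>) (overlap Q \<beta> \<alpha>) (glue Q \<alpha> \<beta>) \<and>
        (\<forall>K\<in>components (overlap Q \<alpha> \<beta>).
           \<exists>F. affine_legendre_equivalence F \<and> (\<forall>p\<in>K. glue Q \<alpha> \<beta> p = F p))) \<and>
     (\<forall>\<alpha>\<in>indices Q. \<forall>\<beta>\<in>indices Q. \<forall>\<gamma>\<in>indices Q.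
        \<forall>p\<in>overlap Q \<alpha> \<beta> \<inter> overlap Q \<alpha> \<gamma>.
          glue Q \<alpha> \<beta> p \<in> overlap Q \<beta> \<gamma> \<and> glue Q \<alpha> \<gamma> p = glue Q \<beta> \<gamma> (glue Q \<alpha> \<beta> p)) \<and>
     Hausdorff_space (glued Q) \<and>
     quotient_map (sum_topology (\<lambda>\<alpha>. top_of_set (model Q \<alpha>)) (indices Q)) (glued Q)
       (\<lambda>(\<alpha>, p). incl Q \<alpha> p) \<and>
     (\<forall>\<alpha>\<in>indices Q. \<forall>\<beta>\<in>indices Q. \<forall>p\<in>model Q \<alpha>. \<forall>q\<in>model Q \<beta>.
        incl Q \<alpha> p = incl Q \<beta> q \<longleftrightarrow> p \<in> overlap Q \<alpha> \<beta> \<and> q = glue Q \<alpha> \<beta> p)"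

text \<open>The tangent bundle of \<open>M\<close> is glued from the tangent bundles of the local models, so a vector
  field on \<open>M\<close> is a family of vector fields on the local models that are related by the
  differentials of the gluing maps.\<close>

definition vector_field ::
  "('i, 'n::finite, 'm) gluing \<Rightarrow> ('i \<Rightarrow> 'n contact \<Rightarrow> 'n contact) \<Rightarrow> bool" where
  "vector_field Q X \<longleftrightarrow>
     (\<forall>\<alpha>\<in>indices Q. smooth_on (model Q \<alpha>) (X \<alpha>) \<and>
        (\<forall>q\<in>model Q \<alpha>. X \<alpha> q \<in> tangent_space (model Q \<alpha>) q)) \<and>
     (\<forall>\<alpha>\<in>indices Q. \<forall>\<beta>\<in>indices Q. \<forall>q\<in>overlap Q \<alpha> \<beta>.
        X \<beta> (glue Q \<alpha> \<beta> q) = dif (overlap Q \<alpha> \<beta>) (glue Q \<alpha> \<beta>) q (X \<alpha> q))"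

text \<open>The function on \<open>M\<close> represented by functions \<open>f \<alpha>\<close> on the local models that are
  compatible with the gluing.\<close>

definition descend ::
  "('i, 'n::finite, 'm) gluing \<Rightarrow> ('i \<Rightarrow> 'n contact \<Rightarrow> real) \<Rightarrow> 'm \<Rightarrow> real" where
  "descend Q f r = (THE t. \<forall>\<alpha>\<in>indices Q. \<forall>q\<in>model Q \<alpha>. incl Q \<alpha> q = r \<longrightarrow> f \<alpha> q = t)"

definition quasi_hessian_metric ::
  "('i, 'n::finite, 'm) gluing \<Rightarrow> ('i \<Rightarrow> 'n contact \<Rightarrow> 'n contact) \<Rightarrow>
    ('i \<Rightarrow> 'n contact \<Rightarrow> 'n contact) \<Rightarrow> 'm \<Rightarrow> real" where
  "quasi_hessian_metric Q Y Z = descend Q (\<lambda>\<alpha> q. local_metric q (Y \<alpha> q) (Z \<alpha> q))"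

definition cubic_tensor ::
  "('i, 'n::finite, 'm) gluing \<Rightarrow> ('i \<Rightarrow> 'n contact \<Rightarrow> 'n contact) \<Rightarrow>
    ('i \<Rightarrow> 'n contact \<Rightarrow> 'n contact) \<Rightarrow> ('i \<Rightarrow> 'n contact \<Rightarrow> 'n contact) \<Rightarrow> 'm \<Rightarrow> real" where
  "cubic_tensor Q X Y Z =
     descend Q (\<lambda>\<alpha>. local_cubic (model Q \<alpha>) (X \<alpha>) (Y \<alpha>) (Z \<alpha>))"


section \<open>Contrast functions\<close>

text \<open>The derivative \<open>X f\<close> of a function \<open>f\<close> on \<open>M\<close>.\<close>

definition act ::
  "('i, 'n::finite, 'm) gluing \<Rightarrow> ('i \<Rightarrow> 'n contact \<Rightarrow> 'n contact) \<Rightarrow> ('m \<Rightarrow> real) \<Rightarrow> 'm \<Rightarrow> real" where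
  "act Q X f = descend Q (\<lambda>\<alpha> q. dif (model Q \<alpha>) (\<lambda>q'. f (incl Q \<alpha> q')) q (X \<alpha> q))"

definition act_fst ::
  "('i, 'n::finite, 'm) gluing \<Rightarrow> ('i \<Rightarrow> 'n contact \<Rightarrow> 'n contact) \<Rightarrow>
    ('m \<times> 'm \<Rightarrow> real) \<Rightarrow> 'm \<times> 'm \<Rightarrow> real" where
  "act_fst Q X \<rho> = (\<lambda>(p, q). act Q X (\<lambda>p'. \<rho> (p', q)) p)"

definition act_snd ::
  "('i, 'n::finite, 'm) gluing \<Rightarrow> ('i \<Rightarrow> 'n contact \<Rightarrow> 'n contact) \<Rightarrow>
    ('m \<times> 'm \<Rightarrow> real) \<Rightarrow> 'm \<times> 'm \<Rightarrow> real" where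
  "act_snd Q Y \<rho> = (\<lambda>(p, q). act Q Y (\<lambda>q'. \<rho> (p, q')) q)"

text \<open>\<open>bracket Q \<rho> [X\<^sub>1, \<dots>, X\<^sub>k] [Y\<^sub>1, \<dots>, Y\<^sub>l]\<close> is
  \<open>\<rho>[X\<^sub>1 \<cdots> X\<^sub>k | Y\<^sub>1 \<cdots> Y\<^sub>l]\<close>; the empty list stands for a dash. Functions \<open>\<rho>\<close>
  defined near the diagonal are total functions here, with irrelevant values away from it: the
  bracket depends only on the germ of \<open>\<rho>\<close> along the diagonal.\<close>

definition bracket ::
  "('i, 'n::finite, 'm) gluing \<Rightarrow> ('m \<times> 'm \<Rightarrow> real) \<Rightarrow>
    ('i \<Rightarrow> 'n contact \<Rightarrow> 'n contact) list \<Rightarrow> ('i \<Rightarrow> 'n contact \<Rightarrow> 'n contact) list \<Rightarrow>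
    'm \<Rightarrow> real" where
  "bracket Q \<rho> Xs Ys r = foldr (act_fst Q) Xs (foldr (act_snd Q) Ys \<rho>) (r, r)"

text \<open>Smoothness of \<open>\<rho>\<close> near the diagonal is part of the notion, all maps being \<open>C\<^sup>\<infinity>\<close>.\<close>

definition smooth_near_diagonal ::
  "('i, 'n::finite, 'm) gluing \<Rightarrow> ('m \<times> 'm \<Rightarrow> real) \<Rightarrow> bool" where
  "smooth_near_diagonal Q \<rho> \<longleftrightarrow>
     (\<exists>W. openin (prod_topology (glued Q) (glued Q)) W \<and> (\<forall>r\<in>topspace (glued Q). (r, r) \<in> W) \<and>
        (\<forall>\<alpha>\<in>indices Q. \<forall>\<beta>\<in>indices Q.
           smooth_on {(p, q). p \<in> model Q \<alpha> \<and> q \<in> model Q \<beta> \<and> (incl Q \<alpha> p, incl Q \<beta> q) \<in> W}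
             (\<lambda>(p, q). \<rho> (incl Q \<alpha> p, incl Q \<beta> q))))"

definition weak_contrast_function ::
  "('i, 'n::finite, 'm) gluing \<Rightarrow> ('m \<times> 'm \<Rightarrow> real) \<Rightarrow> bool" where
  "weak_contrast_function Q \<rho> \<longleftrightarrow>
     smooth_near_diagonal Q \<rho> \<and>
     (\<forall>r\<in>topspace (glued Q). bracket Q \<rho> [] [] r = 0) \<and>
     (\<forall>X. vector_field Q X \<longrightarrow>
        (\<forall>r\<in>topspace (glued Q). bracket Q \<rho> [X] [] r = 0 \<and> bracket Q \<rho> [] [X] r = 0))"

text \<open>\<open>\<rho>\<close> represents the germ along the diagonal of the canonical divergence. Two points may lie in
  different components of an overlap \<open>L\<^sub>\<alpha>\<^sub>\<beta>\<close>, where the gluing is given by different affine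
  Legendre equivalences; the divergences of \<open>L\<^sub>\<alpha>\<close> and \<open>L\<^sub>\<beta>\<close> therefore agree only near the
  diagonal, and \<open>\<rho>\<close> is required to coincide with that of each local model only there. Such \<open>\<rho>\<close>
  exist and all have the same germ: cover \<open>M\<close> by open \<open>B\<^sub>0, B\<^sub>1, \<dots>\<close> whose closures are contained in
  local models \<open>L\<^sub>\<alpha>\<^sub>0, L\<^sub>\<alpha>\<^sub>1, \<dots>\<close> and at \<open>(r, s)\<close> use the model of the first \<open>B\<^sub>k\<close> containing both
  \<open>r\<close> and \<open>s\<close>.\<close>

definition canonical_divergence ::
  "('i, 'n::finite, 'm) gluing \<Rightarrow> ('m \<times> 'm \<Rightarrow> real) \<Rightarrow> bool" where
  "canonical_divergence Q \<rho> \<longleftrightarrow>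
     (\<forall>\<alpha>\<in>indices Q. \<exists>W.
        openin (top_of_set (model Q \<alpha> \<times> model Q \<alpha>)) W \<and> (\<forall>q\<in>model Q \<alpha>. (q, q) \<in> W) \<and>
        (\<forall>(p, q)\<in>W. \<rho> (incl Q \<alpha> p, incl Q \<alpha> q) = local_divergence p q))"

end

theory Submission
  imports Defs
begin

text \<open>
  Brackets at a point of \<open>M\<close> can be computed in any local model containing it, and near the
  diagonal of a model \<open>D(a, b) = z(a) + z'(b) - x(a) \<bullet> p(b)\<close>. Since \<open>dz = p \<bullet> dx\<close> and
  \<open>dz' = x \<bullet> dp\<close> along a Legendre submanifold, \<open>Y\<close> acting on the second variable yields
  \<open>(x(b) - x(a)) \<bullet> dp(Y)\<close>, and the other brackets follow by differentiating this expression. The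
  metric agrees with \<open>dx(X) \<bullet> dp(Y)\<close> because this form is symmetric on tangent vectors
  (\<open>d\<theta> = 0\<close> on \<open>L\<close>), and \<open>C\<close> agrees with its bracket expression by differentiating
  \<open>dx(Y) \<bullet> dp(Z) = dx(Z) \<bullet> dp(Y)\<close> along \<open>X\<close>. As a bracket has the same value in every model,
  this also shows that the local expressions of the metric and of \<open>C\<close> fit together on \<open>M\<close>.
\<close>

section \<open>Functions of class \<open>C\<^sup>k\<close>\<close>

lemma Ck_on_subset: "Ck_on k f S \<Longrightarrow> T \<subseteq> S \<Longrightarrow> Ck_on k f T"
  by (induction k arbitrary: f) (auto intro: continuous_on_subset)

text \<open>The recursion constrains only the directional derivatives at the next level, so the
  lower class of \<open>f\<close> itself comes by induction, with continuity of differentiable maps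
  at the bottom.\<close>

lemma Ck_on_Suc_D: "Ck_on (Suc k) f S \<Longrightarrow> Ck_on k f S"
proof (induction k arbitrary: f)
  case 0
  then show ?case
    by (auto intro!: continuous_at_imp_continuous_on differentiable_imp_continuous_within)
next
  case (Suc k)
  from Suc.prems have "\<forall>v. Ck_on k (\<lambda>x. frechet_derivative f (at x) v) S"
    unfolding Ck_on.simps(2)[of "Suc k"] by (blast intro: Suc.IH)
  then show ?case using Suc.prems by simp
qed

text \<open>On an open set, agreement of two maps forces agreement of their derivatives at every
  point, so it propagates through the recursion.\<close>

lemma Ck_on_cong:
  assumes "open S" "\<And>x. x \<in> S \<Longrightarrow> f x = g x" "Ck_on k f S"
  shows "Ck_on k g S"
  using assms(2,3)
proof (induction k arbitrary: f g)
  case 0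
  then show ?case by (simp cong: continuous_on_cong)
next
  case (Suc k)
  have "f differentiable (at x)" if "x \<in> S" for x
    using Suc.prems that by simp
  then have d: "(g has_derivative frechet_derivative f (at x)) (at x)" if "x \<in> S" for x
    using that has_derivative_transform_within_open[OF _ \<open>open S\<close> that Suc.prems(1)]
    by (simp add: frechet_derivative_works)
  then have eq: "frechet_derivative f (at x) v = frechet_derivative g (at x) v" if "x \<in> S" for x v
    using fun_cong[OF frechet_derivative_at[OF d[OF that]]] by simp
  have "Ck_on k (\<lambda>x. frechet_derivative g (at x) v) S" for v
    by (rule Suc.IH[of "\<lambda>x. frechet_derivative f (at x) v"]) (use Suc.prems(2) eq in auto)
  then show ?case using d unfolding Ck_on.simps(2) differentiable_def by blast
qed

text \<open>Lets an explicit derivative formula replace \<open>frechet_derivative\<close>; the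
  closure properties below are inductions on \<open>k\<close> through this rule.\<close>

lemma Ck_on_SucI:
  assumes "open S" "\<And>x. x \<in> S \<Longrightarrow> (f has_derivative f' x) (at x)"
    and "\<And>v. Ck_on k (\<lambda>x. f' x v) S"
  shows "Ck_on (Suc k) f S"
proof -
  have "f' x v = frechet_derivative f (at x) v" if "x \<in> S" for x v
    using frechet_derivative_at[OF assms(2)[OF that]] by simp
  then have "Ck_on k (\<lambda>x. frechet_derivative f (at x) v) S" for v
    by (rule Ck_on_cong[OF assms(1) _ assms(3)[of v]])
  then show ?thesis using assms(2) unfolding Ck_on.simps(2) differentiable_def by blast
qed

lemma Ck_on_bounded_linear:
  assumes L: "bounded_linear L" and S: "open S" and f: "Ck_on k f S"
  shows "Ck_on k (\<lambda>x. L (f x)) S"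
  using f
proof (induction k arbitrary: f)
  case 0
  then show ?case using bounded_linear.continuous_on[OF L] by auto
next
  case (Suc k)
  have "((\<lambda>x. L (f x)) has_derivative (\<lambda>v. L (frechet_derivative f (at x) v))) (at x)"
    if "x \<in> S" for x
    using Suc.prems that by (intro bounded_linear.has_derivative[OF L]) (simp add: frechet_derivative_works)
  moreover have "Ck_on k (\<lambda>x. L (frechet_derivative f (at x) v)) S" for v
    by (rule Suc.IH) (use Suc.prems in simp)
  ultimately show ?case by (rule Ck_on_SucI[OF S])
qed

lemma Ck_on_add:
  assumes S: "open S" and f: "Ck_on k f S" and g: "Ck_on k g S"
  shows "Ck_on k (\<lambda>x. f x + g x) S"
  using f g
proof (induction k arbitrary: f g)
  case 0
  then show ?case by (simp add: continuous_on_add)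
next
  case (Suc k)
  have "((\<lambda>x. f x + g x) has_derivative
      (\<lambda>v. frechet_derivative f (at x) v + frechet_derivative g (at x) v)) (at x)" if "x \<in> S" for x
    using Suc.prems that by (intro has_derivative_add) (simp_all add: frechet_derivative_works)
  moreover have "Ck_on k (\<lambda>x. frechet_derivative f (at x) v + frechet_derivative g (at x) v) S" for v
    by (rule Suc.IH) (use Suc.prems in simp_all)
  ultimately show ?case by (rule Ck_on_SucI[OF S])
qed

lemma Ck_on_diff:
  assumes S: "open S" and f: "Ck_on k f S" and g: "Ck_on k g S"
  shows "Ck_on k (\<lambda>x. f x - g x) S"
  using Ck_on_add[OF S f Ck_on_bounded_linear[OF bounded_linear_minus[OF bounded_linear_ident] S g]] by simp

text \<open>By the product rule a directional derivative is a sum of two terms of the same shape,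
  each pairing an undifferentiated factor with a differentiated one; hence both factors are also
  needed at the lower class.\<close>

lemma Ck_on_bounded_bilinear:
  assumes B: "bounded_bilinear B" and S: "open S" and f: "Ck_on k f S" and g: "Ck_on k g S"
  shows "Ck_on k (\<lambda>x. B (f x) (g x)) S"
  using f g
proof (induction k arbitrary: f g)
  case 0
  then show ?case using bounded_bilinear.continuous_on[OF B] by auto
next
  case (Suc k)
  note fg = Ck_on_Suc_D[OF Suc.prems(1)] Ck_on_Suc_D[OF Suc.prems(2)]
  show ?case
  proof (rule Ck_on_SucI[OF S])
    fix x assume "x \<in> S"
    then show "((\<lambda>x. B (f x) (g x)) has_derivative
        (\<lambda>v. B (f x) (frechet_derivative g (at x) v) + B (frechet_derivative f (at x) v) (g x))) (at x)"
      using Suc.prems by (intro bounded_bilinear.FDERIV[OF B]) (auto simp: frechet_derivative_works)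
  next
    fix v
    show "Ck_on k (\<lambda>x. B (f x) (frechet_derivative g (at x) v) +
        B (frechet_derivative f (at x) v) (g x)) S"
      by (rule Ck_on_add[OF S Suc.IH Suc.IH]) (use Suc.prems fg in auto)
  qed
qed

text \<open>The inner map has constant derivative \<open>L\<close>, so a directional derivative is
  again a map composed with the same affine map and the induction closes without a general chain
  rule. It serves for charts along lines and for projections of products.\<close>

lemma Ck_on_affine:
  assumes L: "bounded_linear L" and S: "open S" and sub: "\<And>x. x \<in> S \<Longrightarrow> L x + c \<in> U"
    and f: "Ck_on k f U"
  shows "Ck_on k (\<lambda>x. f (L x + c)) S"
  using f
proof (induction k arbitrary: f)
  case 0
  have "continuous_on S (\<lambda>x. L x + c)"
    by (intro continuous_intros bounded_linear.continuous_on[OF L])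
  then show ?case using 0 sub by (auto intro: continuous_on_compose2)
next
  case (Suc k)
  show ?case
  proof (rule Ck_on_SucI[OF S])
    fix x assume "x \<in> S"
    have "((\<lambda>x. L x + c) has_derivative L) (at x)"
      using has_derivative_add[OF bounded_linear_imp_has_derivative[OF L] has_derivative_const[of c]]
      by simp
    moreover have "(f has_derivative frechet_derivative f (at (L x + c))) (at (L x + c))"
      using Suc.prems sub[OF \<open>x \<in> S\<close>] by (simp add: frechet_derivative_works)
    ultimately show "((\<lambda>x. f (L x + c)) has_derivative
        (\<lambda>v. frechet_derivative f (at (L x + c)) (L v))) (at x)"
      by (rule has_derivative_compose)
  next
    fix v
    show "Ck_on k (\<lambda>x. frechet_derivative f (at (L x + c)) (L v)) S"
      by (rule Suc.IH) (use Suc.prems in auto)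
  qed
qed

section \<open>Symmetry of second derivatives (Schwarz's theorem)\<close>

lemma Ck_on_symmetric_real:
  fixes f :: "'a::euclidean_space \<Rightarrow> real"
  assumes S: "open S" and f: "Ck_on 2 f S" and u: "u \<in> S"
  shows "frechet_derivative (\<lambda>x. frechet_derivative f (at x) a) (at u) b =
         frechet_derivative (\<lambda>x. frechet_derivative f (at x) b) (at u) a"
proof -
  let ?D = "\<lambda>f v x. frechet_derivative f (at x) v"
  have f1: "(f has_derivative (\<lambda>v. ?D f v x)) (at x)" if "x \<in> S" for x
    using f that by (simp add: numeral_2_eq_2 frechet_derivative_works)
  have f2: "(?D f w has_derivative (\<lambda>v. ?D (?D f w) v x)) (at x)" if "x \<in> S" for x w
    using f that by (simp add: numeral_2_eq_2 frechet_derivative_works)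
  have cont: "isCont (?D (?D f w) v) u" for v w
    using f u by (auto simp: numeral_2_eq_2 continuous_on_eq_continuous_at[OF S])
  have deriv_line: "((\<lambda>t. g (c + t *\<^sub>R v)) has_real_derivative ?D g v (c + t *\<^sub>R v)) (at t)"
    if g: "(g has_derivative (\<lambda>w. ?D g w (c + t *\<^sub>R v))) (at (c + t *\<^sub>R v))"
    for g :: "'a \<Rightarrow> real" and c v :: 'a and t :: real
  proof -
    have "((\<lambda>t. c + t *\<^sub>R v) has_derivative (\<lambda>h. h *\<^sub>R v)) (at t)"
      by (auto intro!: derivative_eq_intros)
    then have "((\<lambda>t. g (c + t *\<^sub>R v)) has_derivative (\<lambda>h. ?D g (h *\<^sub>R v) (c + t *\<^sub>R v))) (at t)"
      by (rule has_derivative_compose) (rule g)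
    moreover have "(\<lambda>h. ?D g (h *\<^sub>R v) (c + t *\<^sub>R v)) = (\<lambda>h. ?D g v (c + t *\<^sub>R v) * h)"
      using linear_scale[OF has_derivative_linear[OF g]] by (auto simp: mult.commute)
    ultimately show ?thesis by (simp add: has_field_derivative_def)
  qed
  \<comment> \<open>Both mixed derivatives arise from the same second difference quotient by the mean value theorem.\<close>
  have mean: "\<exists>x\<in>ball u (h * (norm v + norm w + 1)).
      f (u + h *\<^sub>R v + h *\<^sub>R w) - f (u + h *\<^sub>R v) - f (u + h *\<^sub>R w) + f u = h * h * ?D (?D f v) w x"
    if h: "h > 0" "ball u (h * (norm v + norm w + 1)) \<subseteq> S" for h v w
  proof -
    \<comment> \<open>The summand 1 in the radius keeps the inequality strict even when
      \<open>v\<close> and \<open>w\<close> vanish.\<close>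
    have inb: "u + s *\<^sub>R v + t *\<^sub>R w \<in> ball u (h * (norm v + norm w + 1))"
      if "0 \<le> s" "s \<le> h" "0 \<le> t" "t \<le> h" for s t
    proof -
      have "norm (s *\<^sub>R v + t *\<^sub>R w) \<le> s * norm v + t * norm w"
        using norm_triangle_ineq[of "s *\<^sub>R v" "t *\<^sub>R w"] that by simp
      also have "\<dots> \<le> h * norm v + h * norm w"
        using that by (intro add_mono mult_right_mono) auto
      also have "\<dots> < h * (norm v + norm w + 1)" using h(1) by (simp add: algebra_simps)
      finally have "norm (s *\<^sub>R v + t *\<^sub>R w) < h * (norm v + norm w + 1)" .
      moreover have "dist u (u + s *\<^sub>R v + t *\<^sub>R w) = norm (s *\<^sub>R v + t *\<^sub>R w)"
        using norm_minus_cancel[of "s *\<^sub>R v + t *\<^sub>R w"] by (simp add: dist_norm)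
      ultimately show ?thesis unfolding mem_ball by linarith
    qed
    then have inS: "u + s *\<^sub>R v + t *\<^sub>R w \<in> S"
      if "0 \<le> s" "s \<le> h" "0 \<le> t" "t \<le> h" for s t using h(2) inb[OF that] by blast
    \<comment> \<open>The mean value theorem is used twice: along \<open>v\<close> for the increment
      of \<open>f\<close> over the step in direction \<open>w\<close>, then along \<open>w\<close>
      for the derivative of \<open>f\<close> in direction \<open>v\<close>.\<close>
    let ?F = "\<lambda>s. f ((u + h *\<^sub>R w) + s *\<^sub>R v) - f (u + s *\<^sub>R v)"
    have "\<exists>s. 0 < s \<and> s < h \<and> ?F h - ?F 0 =
        (h - 0) * (?D f v ((u + h *\<^sub>R w) + s *\<^sub>R v) - ?D f v (u + s *\<^sub>R v))"
    proof (rule MVT2[OF \<open>h > 0\<close>])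
      fix s assume s: "0 \<le> s" "s \<le> h"
      have "(u + h *\<^sub>R w) + s *\<^sub>R v \<in> S" "u + s *\<^sub>R v \<in> S"
        using inS[of s h] inS[of s 0] s h by (simp_all add: ac_simps)
      then show "(?F has_real_derivative
          ?D f v ((u + h *\<^sub>R w) + s *\<^sub>R v) - ?D f v (u + s *\<^sub>R v)) (at s)"
        by (intro DERIV_diff deriv_line f1)
    qed
    then obtain s where s: "0 < s" "s < h" and eq1: "?F h - ?F 0 =
        h * (?D f v ((u + h *\<^sub>R w) + s *\<^sub>R v) - ?D f v (u + s *\<^sub>R v))" by auto
    let ?G = "\<lambda>t. ?D f v ((u + s *\<^sub>R v) + t *\<^sub>R w)"
    have "\<exists>t. 0 < t \<and> t < h \<and> ?G h - ?G 0 = (h - 0) * ?D (?D f v) w ((u + s *\<^sub>R v) + t *\<^sub>R w)"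
      using inS[of s] s by (intro MVT2[OF \<open>h > 0\<close>] deriv_line f2) auto
    then obtain t where t: "0 < t" "t < h"
      and eq2: "?G h - ?G 0 = h * ?D (?D f v) w ((u + s *\<^sub>R v) + t *\<^sub>R w)" by auto
    have "f (u + h *\<^sub>R v + h *\<^sub>R w) - f (u + h *\<^sub>R v) - f (u + h *\<^sub>R w) + f u = ?F h - ?F 0"
      by (simp add: ac_simps)
    also have "\<dots> = h * (?G h - ?G 0)"
      unfolding eq1 by (simp add: ac_simps)
    finally show ?thesis unfolding eq2
      using inb[of s t] s t by (intro bexI[of _ "u + s *\<^sub>R v + t *\<^sub>R w"]) simp_all
  qed
  let ?c = "norm a + norm b + 1"
  have c: "?c > 0" by (smt (verit) norm_ge_zero)
  obtain r where r: "r > 0" "ball u r \<subseteq> S" using S u openE by blast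
  have "dist (?D (?D f a) b u) (?D (?D f b) a u) < e" if "e > 0" for e
  proof -
    obtain d1 where d1: "d1 > 0" "\<And>x. dist x u < d1 \<Longrightarrow> dist (?D (?D f a) b x) (?D (?D f a) b u) < e / 2"
      using cont[of a b] \<open>e > 0\<close> unfolding continuous_at_eps_delta by (meson half_gt_zero)
    obtain d2 where d2: "d2 > 0" "\<And>x. dist x u < d2 \<Longrightarrow> dist (?D (?D f b) a x) (?D (?D f b) a u) < e / 2"
      using cont[of b a] \<open>e > 0\<close> unfolding continuous_at_eps_delta by (meson half_gt_zero)
    \<comment> \<open>The ball supplied by \<open>mean\<close> then has radius exactly
      \<open>Min {r, d1, d2}\<close>: it lies in \<open>S\<close> and within both continuity
      neighbourhoods of \<open>u\<close>.\<close>
    define h where "h = Min {r, d1, d2} / ?c"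
    have h: "h > 0" using r d1 d2 c by (auto simp: h_def)
    have hc: "h * ?c = Min {r, d1, d2}" using c by (simp add: h_def)
    then have "ball u (h * ?c) \<subseteq> S" using r by fastforce
    \<comment> \<open>The ball and the second difference are symmetric in \<open>a\<close> and
      \<open>b\<close>, so one difference is expressed through both mixed derivatives.\<close>
    moreover have swap: "norm b + norm a + 1 = ?c"
      "f (u + h *\<^sub>R b + h *\<^sub>R a) - f (u + h *\<^sub>R b) - f (u + h *\<^sub>R a) + f u =
       f (u + h *\<^sub>R a + h *\<^sub>R b) - f (u + h *\<^sub>R a) - f (u + h *\<^sub>R b) + f u"
      by (simp_all add: ac_simps)
    ultimately obtain x y where xy: "x \<in> ball u (h * ?c)" "y \<in> ball u (h * ?c)"
      "h * h * ?D (?D f a) b x = h * h * ?D (?D f b) a y"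
      using mean[OF h, of a b] mean[OF h, of b a, unfolded swap] by metis
    then have "?D (?D f a) b x = ?D (?D f b) a y" using h by simp
    moreover have "dist x u < d1" "dist y u < d2"
      using xy(1,2) unfolding hc by (auto simp: dist_commute)
    ultimately show ?thesis using d1(2)[of x] d2(2)[of y]
      by (metis dist_commute dist_triangle_half_l)
  qed
  then show ?thesis by (metis dist_eq_0_iff less_irrefl zero_less_dist_iff)
qed

text \<open>Reduction to the scalar case: the inner product with a fixed \<open>e\<close> is bounded
  linear and passes through both differentiations.\<close>

lemma Ck_on_symmetric:
  fixes f :: "'a::euclidean_space \<Rightarrow> 'b::euclidean_space"
  assumes S: "open S" and f: "Ck_on 2 f S" and u: "u \<in> S"
  shows "frechet_derivative (\<lambda>x. frechet_derivative f (at x) a) (at u) b =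
         frechet_derivative (\<lambda>x. frechet_derivative f (at x) b) (at u) a"
proof (rule euclidean_eqI)
  fix e :: 'b
  have bl: "bounded_linear (\<lambda>y. y \<bullet> e)" by (rule bounded_linear_inner_left)
  have f1: "(f has_derivative frechet_derivative f (at x)) (at x)" if "x \<in> S" for x
    using f that by (simp add: numeral_2_eq_2 frechet_derivative_works)
  have e1: "frechet_derivative (\<lambda>x. f x \<bullet> e) (at x) v = frechet_derivative f (at x) v \<bullet> e" if "x \<in> S" for x v
    using fun_cong[OF frechet_derivative_at[OF bounded_linear.has_derivative[OF bl f1[OF that]]]] by simp
  have e2: "frechet_derivative (\<lambda>x. frechet_derivative (\<lambda>x. f x \<bullet> e) (at x) w) (at u) v =
      frechet_derivative (\<lambda>x. frechet_derivative f (at x) w) (at u) v \<bullet> e" for v w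
  proof -
    have "((\<lambda>x. frechet_derivative f (at x) w) has_derivative
        frechet_derivative (\<lambda>x. frechet_derivative f (at x) w) (at u)) (at u)"
      using f u by (simp add: numeral_2_eq_2 frechet_derivative_works)
    from has_derivative_transform_within_open[OF bounded_linear.has_derivative[OF bl this] S u
        e1[symmetric]]
    show ?thesis using fun_cong[OF frechet_derivative_at] by fastforce
  qed
  show "frechet_derivative (\<lambda>x. frechet_derivative f (at x) a) (at u) b \<bullet> e =
         frechet_derivative (\<lambda>x. frechet_derivative f (at x) b) (at u) a \<bullet> e"
    using Ck_on_symmetric_real[OF S Ck_on_bounded_linear[OF bl S f] u] unfolding e2 .
qed


section \<open>Tangent vectors and Legendre submanifolds\<close>

lemma smooth_onE:
  assumes "smooth_on S f" "q \<in> S"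
  obtains U g where "open U" "q \<in> U" "\<And>k. Ck_on k g U" "\<And>x. x \<in> U \<inter> S \<Longrightarrow> g x = f x"
proof -
  from assms have "\<exists>U g. open U \<and> q \<in> U \<and> (\<forall>k. Ck_on k g U) \<and> (\<forall>x\<in>U \<inter> S. g x = f x)"
    unfolding smooth_on_def by (rule bspec)
  then show ?thesis using that by blast
qed

text \<open>A local smooth extension is differentiable at \<open>q\<close> in the ambient space; its
  derivative restricts to \<open>S\<close>, where near \<open>q\<close> the extension equals
  \<open>f\<close>.\<close>

lemma smooth_on_has_derivative:
  assumes "smooth_on S f" "q \<in> S"
  obtains f' where "(f has_derivative f') (at q within S)"
proof -
  obtain U g where U: "open U" "q \<in> U" "\<And>k. Ck_on k g U" "\<And>x. x \<in> U \<inter> S \<Longrightarrow> g x = f x"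
    using smooth_onE[OF assms] by metis
  have "(g has_derivative frechet_derivative g (at q)) (at q within S)"
    using U(2) U(3)[of "Suc 0"] by (simp add: frechet_derivative_works has_derivative_at_withinI)
  then have "(g has_derivative frechet_derivative g (at q)) (at q within (S \<inter> U))"
    by (rule has_derivative_subset) auto
  then have "(f has_derivative frechet_derivative g (at q)) (at q within (S \<inter> U))"
    by (rule has_derivative_transform[rotated 2]) (use assms(2) U in auto)
  moreover have "at q within (S \<inter> U) = at q within S"
    using U by (intro at_within_nhd[of q U]) auto
  ultimately show ?thesis using that by simp
qed

text \<open>Chain rule along a curve in \<open>L\<close>. The velocity on the left does not depend
  on which relative derivative was chosen, which makes differentials well defined on tangent
  vectors.\<close>

lemma has_derivative_within_curve:
  assumes f: "(f has_derivative f') (at q within L)"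
    and c: "\<epsilon> > 0" "c ` {-\<epsilon><..<\<epsilon>} \<subseteq> L" "c 0 = q" "(c has_vector_derivative v) (at (0::real))"
  shows "((\<lambda>t. f (c t)) has_vector_derivative f' v) (at 0)"
proof -
  have at: "at (0::real) within {-\<epsilon><..<\<epsilon>} = at 0" by (rule at_within_open) (use c(1) in auto)
  have 1: "(c has_derivative (\<lambda>h. h *\<^sub>R v)) (at 0 within {-\<epsilon><..<\<epsilon>})"
    using c(4) unfolding has_vector_derivative_def by (rule has_derivative_at_withinI)
  have 2: "(f has_derivative f') (at (c 0) within c ` {-\<epsilon><..<\<epsilon>})"
    unfolding c(3) by (rule has_derivative_subset[OF f c(2)])
  have "f' (h *\<^sub>R v) = h *\<^sub>R f' v" for h
    using linear_scale[OF has_derivative_linear[OF f]] .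
  then show ?thesis
    using has_derivative_in_compose[OF 1 2] unfolding at has_vector_derivative_def by simp
qed

text \<open>\<open>dif\<close> takes some relative derivative by choice, but any two of them give
  the velocity of \<open>f\<close> along a curve with velocity \<open>v\<close>.\<close>

lemma dif_eq:
  assumes f: "(f has_derivative f') (at q within L)" and v: "v \<in> tangent_space L q"
  shows "dif L f q v = f' v"
proof -
  obtain \<epsilon> c where c: "\<epsilon> > 0" "c ` {-\<epsilon><..<\<epsilon>} \<subseteq> L" "c 0 = q" "(c has_vector_derivative v) (at (0::real))"
    using v unfolding tangent_space_def by blast
  have "(f has_derivative frechet_derivative f (at q within L)) (at q within L)"
    using f by (auto simp: differentiable_def simp flip: frechet_derivative_works)
  from vector_derivative_unique_at[OF has_derivative_within_curve[OF this c]
      has_derivative_within_curve[OF f c]]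
  show ?thesis by (simp add: dif_def)
qed

lemma bounded_linear_coords: "bounded_linear xc" "bounded_linear pc" "bounded_linear zc"
  using coord_derivs has_derivative_bounded_linear by blast+

lemma coord_derivs_within:
  "(xc has_derivative xc) (at q within A)" "(pc has_derivative pc) (at q within A)"
  "(zc has_derivative zc) (at q within A)"
  by (rule has_derivative_at_withinI, rule coord_derivs)+

lemmas coord_has_derivative =
  bounded_linear.has_derivative[OF bounded_linear_coords(1)]
  bounded_linear.has_derivative[OF bounded_linear_coords(2)]

text \<open>The chart carries a short straight segment through \<open>u\<close> in direction
  \<open>a\<close> to a smooth curve in \<open>L\<close>.\<close>

lemma chart_velocity_in_tangent_space:
  fixes \<phi> :: "'a::euclidean_space \<Rightarrow> 'b::euclidean_space"
  assumes W: "open W" and \<phi>: "\<And>k. Ck_on k \<phi> W" "\<phi> ` W \<subseteq> L" and u: "u \<in> W"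
  shows "frechet_derivative \<phi> (at u) a \<in> tangent_space L (\<phi> u)"
proof -
  have line: "((\<lambda>t. t *\<^sub>R a + u) has_vector_derivative a) (at 0)"
    by (auto intro!: derivative_eq_intros)
  have "open ((\<lambda>t::real. t *\<^sub>R a + u) -` W)"
    by (intro open_vimage W continuous_intros)
  moreover have "0 \<in> (\<lambda>t::real. t *\<^sub>R a + u) -` W" using u by simp
  ultimately obtain \<epsilon> where e: "\<epsilon> > 0" "ball 0 \<epsilon> \<subseteq> (\<lambda>t::real. t *\<^sub>R a + u) -` W"
    using openE by blast
  then have sub: "t *\<^sub>R a + u \<in> W" if "t \<in> {-\<epsilon><..<\<epsilon>}" for t
    using that by (force simp: dist_real_def)
  have "Ck_on k (\<lambda>t. \<phi> (t *\<^sub>R a + u)) {-\<epsilon><..<\<epsilon>}" for k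
    by (rule Ck_on_affine[OF bounded_linear_scaleR_left _ _ \<phi>(1)]) (use sub in auto)
  then have "smooth_on {-\<epsilon><..<\<epsilon>} (\<lambda>t. \<phi> (t *\<^sub>R a + u))"
    unfolding smooth_on_def by (intro ballI exI[of _ "{-\<epsilon><..<\<epsilon>}"] exI[of _ "\<lambda>t. \<phi> (t *\<^sub>R a + u)"]) auto
  moreover have "(\<phi> has_derivative frechet_derivative \<phi> (at u)) (at u within W)"
    using \<phi>(1)[of "Suc 0"] u by (simp add: frechet_derivative_works has_derivative_at_withinI)
  from has_derivative_within_curve[OF this e(1) _ _ line] sub
  have "((\<lambda>t. \<phi> (t *\<^sub>R a + u)) has_vector_derivative frechet_derivative \<phi> (at u) a) (at 0)"
    by (simp add: image_subset_iff)
  ultimately show ?thesis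
    unfolding tangent_space_def using e(1) sub \<phi>(2)
    by (auto intro!: exI[of _ \<epsilon>] exI[of _ "\<lambda>t. \<phi> (t *\<^sub>R a + u)"])
qed

text \<open>Converse direction: a curve in \<open>L\<close> with velocity \<open>v\<close> is pulled
  back by the inverse chart, and the velocity of the pulled-back curve is the required
  \<open>a\<close>.\<close>

lemma tangent_vector_chart_velocity:
  fixes \<phi> :: "'a::euclidean_space \<Rightarrow> 'b::euclidean_space"
  assumes \<phi>: "diffeomorphism V (L \<inter> U) \<phi>" and V: "open V" and U: "open U"
    and q: "q \<in> L \<inter> U" and d: "\<phi> differentiable (at (inv_into V \<phi> q))"
    and v: "v \<in> tangent_space L q"
  obtains a where "v = frechet_derivative \<phi> (at (inv_into V \<phi> q)) a"
proof -
  let ?\<psi> = "inv_into V \<phi>"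
  obtain \<epsilon> c where c: "\<epsilon> > 0" "c ` {-\<epsilon><..<\<epsilon>} \<subseteq> L" "c 0 = q" "(c has_vector_derivative v) (at (0::real))"
    using v unfolding tangent_space_def by blast
  obtain \<psi>' where "(?\<psi> has_derivative \<psi>') (at q within L \<inter> U)"
    using smooth_on_has_derivative \<phi> q unfolding diffeomorphism_def by blast
  moreover have "at q within L \<inter> U = at q within L"
    using q U by (intro at_within_nhd[of q U]) auto
  ultimately have \<psi>': "(?\<psi> has_derivative \<psi>') (at q within L)" by simp
  have \<psi>c: "((\<lambda>t. ?\<psi> (c t)) has_derivative (\<lambda>h. h *\<^sub>R \<psi>' v)) (at 0)"
    using has_derivative_within_curve[OF \<psi>' c] by (simp add: has_vector_derivative_def)
  have "(\<phi> has_derivative frechet_derivative \<phi> (at (?\<psi> (c 0)))) (at (?\<psi> (c 0)))"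
    using d c(3) by (simp add: frechet_derivative_works)
  from has_derivative_compose[OF \<psi>c this]
  have *: "((\<lambda>t. \<phi> (?\<psi> (c t))) has_derivative (\<lambda>h. frechet_derivative \<phi> (at (?\<psi> q)) (h *\<^sub>R \<psi>' v))) (at 0)"
    using c(3) by simp
  have "isCont c 0" using c(4) has_vector_derivative_continuous by blast
  \<comment> \<open>The curve stays in \<open>L\<close> but may leave the chart domain
    \<open>U\<close>; the chart and its inverse cancel along it only near time 0, which determines
    the derivative.\<close>
  then have "\<forall>\<^sub>F t in at 0. c t \<in> U"
    using U q c(3) by (auto simp: isCont_def dest: topological_tendstoD)
  moreover have "\<forall>\<^sub>F t in at 0. t \<in> {-\<epsilon><..<\<epsilon>}"
    using c(1) by (intro eventually_at_in_open') auto
  ultimately have "\<forall>\<^sub>F t in at 0. \<phi> (?\<psi> (c t)) = c t"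
  proof eventually_elim
    case (elim t)
    then have "c t \<in> \<phi> ` V" using c(2) \<phi> by (auto simp: diffeomorphism_def bij_betw_def)
    then show ?case by (rule f_inv_into_f)
  qed
  moreover have "\<phi> (?\<psi> (c 0)) = c 0"
    using q \<phi> c(3) by (auto simp: diffeomorphism_def bij_betw_def intro!: f_inv_into_f)
  ultimately have "(c has_derivative (\<lambda>h. frechet_derivative \<phi> (at (?\<psi> q)) (h *\<^sub>R \<psi>' v))) (at 0)"
    using has_derivative_transform_eventually[OF *] by simp
  moreover have "linear (frechet_derivative \<phi> (at (?\<psi> q)))" using d by (rule linear_frechet_derivative)
  ultimately have "(c has_vector_derivative frechet_derivative \<phi> (at (?\<psi> q)) (\<psi>' v)) (at 0)"
    by (simp add: has_vector_derivative_def linear_scale)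
  with c(4) show ?thesis using that vector_derivative_unique_at by blast
qed

text \<open>On \<open>L\<close> the form \<open>\<theta>\<close> vanishes, hence so does \<open>d\<theta> = \<Sum>\<^sub>i dx\<^sub>i \<and> dp\<^sub>i\<close>.\<close>

lemma legendre_symmetric:
  fixes L :: "'n::finite contact set"
  assumes L: "legendre_submanifold L" and q: "q \<in> L"
    and v: "v \<in> tangent_space L q" and w: "w \<in> tangent_space L q"
  shows "xc v \<bullet> pc w = xc w \<bullet> pc v"
proof -
  obtain U V and \<phi> :: "real^'n \<Rightarrow> 'n contact"
    where U: "open U" "q \<in> U" and V: "open V" and \<phi>: "diffeomorphism V (L \<inter> U) \<phi>"
    using L q unfolding legendre_submanifold_def n_submanifold_def by metis
  define u where "u = inv_into V \<phi> q"
  have im: "\<phi> ` V = L \<inter> U" using \<phi> by (auto simp: diffeomorphism_def bij_betw_def)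
  then have "q \<in> \<phi> ` V" using q U by simp
  then have u: "u \<in> V" "\<phi> u = q" unfolding u_def by (rule inv_into_into, rule f_inv_into_f)
  obtain N g where N: "open N" "u \<in> N" "\<And>k. Ck_on k g N" "\<And>x. x \<in> N \<inter> V \<Longrightarrow> g x = \<phi> x"
    using smooth_onE[of V \<phi> u] \<phi> u(1) unfolding diffeomorphism_def by metis
  define W where "W = N \<inter> V"
  have W: "open W" "u \<in> W" using N V u by (auto simp: W_def)
  \<comment> \<open>Smoothness of a chart means local extendability; on the open set
    \<open>W\<close> the extension coincides with \<open>\<phi>\<close>, so \<open>\<phi>\<close>
    itself has all derivatives there.\<close>
  have Ck: "Ck_on k \<phi> W" for k
    by (rule Ck_on_cong[OF W(1) _ Ck_on_subset[OF N(3)]]) (auto simp: W_def N(4))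
  have imW: "\<phi> ` W \<subseteq> L" using im by (auto simp: W_def)
  let ?D = "\<lambda>a u. frechet_derivative \<phi> (at u) a"
  have d1: "(\<phi> has_derivative (\<lambda>a. ?D a x)) (at x)" if "x \<in> W" for x
    using Ck[of "Suc 0"] that by (simp add: frechet_derivative_works)
  have d2: "(?D a has_derivative frechet_derivative (?D a) (at u)) (at u)" for a
    using Ck[of 2] W(2) by (simp add: numeral_2_eq_2 frechet_derivative_works)
  have leg: "zc (?D a x) = pc (\<phi> x) \<bullet> xc (?D a x)" if "x \<in> W" for a x
  proof -
    have "?D a x \<in> tangent_space L (\<phi> x)"
      by (rule chart_velocity_in_tangent_space[OF W(1) Ck imW that])
    then show ?thesis using L imW that
      by (auto simp: legendre_submanifold_def contact_form_def inner_vec_def)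
  qed
  \<comment> \<open>The Legendre condition \<open>leg\<close> holds throughout \<open>W\<close>, so
    it can be differentiated in direction \<open>b\<close>. Exchanging \<open>a\<close> and
    \<open>b\<close> leaves the second-derivative terms unchanged, and only the first-order products
    remain to be compared.\<close>
  have second: "zc (frechet_derivative (?D a) (at u) b) =
      pc q \<bullet> xc (frechet_derivative (?D a) (at u) b) + pc (?D b u) \<bullet> xc (?D a u)" for a b
  proof -
    have "((\<lambda>x. pc (\<phi> x) \<bullet> xc (?D a x)) has_derivative
        (\<lambda>b. pc (\<phi> u) \<bullet> xc (frechet_derivative (?D a) (at u) b) + pc (?D b u) \<bullet> xc (?D a u))) (at u)"
      by (intro has_derivative_inner bounded_linear.has_derivative[OF bounded_linear_coords(1)]
          bounded_linear.has_derivative[OF bounded_linear_coords(2)] d1 d2 W)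
    from has_derivative_transform_within_open[OF this W leg[symmetric]]
    have "((\<lambda>x. zc (?D a x)) has_derivative
        (\<lambda>b. pc (\<phi> u) \<bullet> xc (frechet_derivative (?D a) (at u) b) + pc (?D b u) \<bullet> xc (?D a u))) (at u)" .
    from has_derivative_unique[OF this bounded_linear.has_derivative[OF bounded_linear_coords(3) d2]]
    show ?thesis using u(2) by metis
  qed
  have "\<phi> differentiable (at u)" using d1[OF W(2)] unfolding differentiable_def by blast
  note chart = tangent_vector_chart_velocity[OF \<phi> V U(1) _ this[unfolded u_def], folded u_def]
  obtain a where a: "v = ?D a u" using chart[of v] v q U(2) by blast
  obtain b where b: "w = ?D b u" using chart[of w] w q U(2) by blast
  have "frechet_derivative (?D a) (at u) b = frechet_derivative (?D b) (at u) a"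
    by (rule Ck_on_symmetric[OF W(1) Ck W(2)])
  with second[of a b] second[of b a] have "pc (?D b u) \<bullet> xc (?D a u) = pc (?D a u) \<bullet> xc (?D b u)"
    by simp
  then show ?thesis by (simp add: a b inner_commute)
qed

lemma legendre_zc:
  assumes "legendre_submanifold L" "q \<in> L" "v \<in> tangent_space L q"
  shows "zc v = pc q \<bullet> xc v"
  using assms by (simp add: legendre_submanifold_def contact_form_def inner_vec_def)

section \<open>Coordinate formulas for the metric and the cubic tensor\<close>

lemma tau_eq:
  assumes "fst u \<in> E_fibre q" "fst v \<in> E_fibre q" "snd u \<in> E'_fibre q" "snd v \<in> E'_fibre q"
  shows "tau q u v = (fst (fst u) \<bullet> fst (snd v) + fst (fst v) \<bullet> fst (snd u)) / 2"
proof -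
  \<comment> \<open>The Kronecker factor collapses the double sum; the frame coefficients left over
    are just the first components of the fibre vectors.\<close>
  have diag: "(\<Sum>j\<in>UNIV. f j * (if i = j then 1/2 else 0)) = f i / 2" for f :: "'a \<Rightarrow> real" and i
    by (simp add: if_distrib[of "\<lambda>x. _ * x"] cong: if_cong)
  show ?thesis
    unfolding tau_def diag frame_coeff_E[OF assms(1)] frame_coeff_E[OF assms(2)]
      frame_coeff_E'[OF assms(3)] frame_coeff_E'[OF assms(4)]
    by (simp add: inner_vec_def sum.distrib flip: sum_divide_distrib)
qed

lemma zero_in_fibres: "0 \<in> E_fibre q" "0 \<in> E'_fibre q"
  by (simp_all add: E_fibre_def E'_fibre_def)

lemma tau_mix_eq:
  assumes "\<eta> \<in> E_fibre q" "\<zeta>' \<in> E'_fibre q"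
  shows "tau_mix q \<eta> \<zeta>' = fst \<eta> \<bullet> fst \<zeta>' / 2"
  using assms unfolding tau_mix_def by (subst tau_eq) (simp_all add: zero_in_fibres)

text \<open>\<open>tau\<close> yields the mean of \<open>xc v \<bullet> pc w\<close> and
  \<open>xc w \<bullet> pc v\<close>, which are equal because the symplectic form vanishes on
  tangent vectors of \<open>L\<close>.\<close>

lemma local_metric_eq:
  assumes L: "legendre_submanifold L" "q \<in> L" and v: "v \<in> tangent_space L q" and w: "w \<in> tangent_space L q"
  shows "local_metric q v w = xc v \<bullet> pc w"
  using Phi_in_fibres[OF L v] Phi_in_fibres[OF L w] legendre_symmetric[OF L v w]
  unfolding local_metric_def by (subst tau_eq) (simp_all add: Phi_eq Phi'_eq)

text \<open>The coefficients of a section of \<open>E\<close> in the flat frame form its first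
  component, so the connection merely differentiates that component. The fibre condition is assumed
  along all of \<open>L\<close> because the coefficients are differentiated there.\<close>

lemma nabla_E_eq:
  assumes \<eta>: "\<And>r. r \<in> L \<Longrightarrow> \<eta> r \<in> E_fibre r" and q: "q \<in> L" "X q \<in> tangent_space L q"
    and d: "((\<lambda>r. fst (\<eta> r)) has_derivative \<eta>') (at q within L)"
  shows "nabla_E L X \<eta> q \<in> E_fibre q" "fst (nabla_E L X \<eta> q) = \<eta>' (X q)"
proof -
  have "((\<lambda>r. frame_coeff (frame_E r) (\<eta> r) $ i) has_derivative (\<lambda>v. \<eta>' v $ i)) (at q within L)" for i
    by (rule has_derivative_transform[OF q(1) _ bounded_linear.has_derivative[OF bounded_linear_vec_nth d]])
      (simp add: frame_coeff_E \<eta>)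
  from dif_eq[OF this q(2)]
  have "nabla_E L X \<eta> q = (\<Sum>i\<in>UNIV. \<eta>' (X q) $ i *\<^sub>R frame_E q i)"
    unfolding flat_connection_def by simp
  then have "nabla_E L X \<eta> q = (\<eta>' (X q), pc q \<bullet> \<eta>' (X q))"
    unfolding frame_E_def frame_sum .
  then show "nabla_E L X \<eta> q \<in> E_fibre q" "fst (nabla_E L X \<eta> q) = \<eta>' (X q)"
    by (simp_all add: E_fibre_def)
qed

lemma nabla_E'_eq:
  assumes \<eta>: "\<And>r. r \<in> L \<Longrightarrow> \<eta> r \<in> E'_fibre r" and q: "q \<in> L" "X q \<in> tangent_space L q"
    and d: "((\<lambda>r. fst (\<eta> r)) has_derivative \<eta>') (at q within L)"
  shows "nabla_E' L X \<eta> q \<in> E'_fibre q" "fst (nabla_E' L X \<eta> q) = \<eta>' (X q)"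
proof -
  have "((\<lambda>r. frame_coeff (frame_E' r) (\<eta> r) $ i) has_derivative (\<lambda>v. \<eta>' v $ i)) (at q within L)" for i
    by (rule has_derivative_transform[OF q(1) _ bounded_linear.has_derivative[OF bounded_linear_vec_nth d]])
      (simp add: frame_coeff_E' \<eta>)
  from dif_eq[OF this q(2)]
  have "nabla_E' L X \<eta> q = (\<Sum>i\<in>UNIV. \<eta>' (X q) $ i *\<^sub>R frame_E' q i)"
    unfolding flat_connection_def by simp
  then have "nabla_E' L X \<eta> q = (\<eta>' (X q), xc q \<bullet> \<eta>' (X q))"
    unfolding frame_E'_def frame_sum .
  then show "nabla_E' L X \<eta> q \<in> E'_fibre q" "fst (nabla_E' L X \<eta> q) = \<eta>' (X q)"
    by (simp_all add: E'_fibre_def)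
qed

text \<open>The first components of the sections induced by \<open>Y\<close> are its
  \<open>x\<close>- and \<open>p\<close>-parts, so the two flat connections both read off
  \<open>Y'\<close>.\<close>

lemma nabla_Phi:
  assumes L: "legendre_submanifold L" and q: "q \<in> L" and X: "X q \<in> tangent_space L q"
    and Y: "\<And>r. r \<in> L \<Longrightarrow> Y r \<in> tangent_space L r" and dY: "(Y has_derivative Y') (at q within L)"
  shows "nabla_E L X (\<lambda>r. Phi r (Y r)) q \<in> E_fibre q"
    "fst (nabla_E L X (\<lambda>r. Phi r (Y r)) q) = xc (Y' (X q))"
    "nabla_E' L X (\<lambda>r. Phi' r (Y r)) q \<in> E'_fibre q"
    "fst (nabla_E' L X (\<lambda>r. Phi' r (Y r)) q) = pc (Y' (X q))"
proof -
  have "((\<lambda>r. fst (Phi r (Y r))) has_derivative (\<lambda>v. xc (Y' v))) (at q within L)"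
    "((\<lambda>r. fst (Phi' r (Y r))) has_derivative (\<lambda>v. pc (Y' v))) (at q within L)"
    using bounded_linear.has_derivative[OF bounded_linear_coords(1) dY]
      bounded_linear.has_derivative[OF bounded_linear_coords(2) dY]
    by (simp_all add: Phi_eq Phi'_eq)
  note d = this
  show "nabla_E L X (\<lambda>r. Phi r (Y r)) q \<in> E_fibre q"
    "fst (nabla_E L X (\<lambda>r. Phi r (Y r)) q) = xc (Y' (X q))"
    by (rule nabla_E_eq[of L _ q X "\<lambda>v. xc (Y' v)", OF _ q X d(1)], rule Phi_in_fibres(1)[OF L _ Y], assumption+)+
  show "nabla_E' L X (\<lambda>r. Phi' r (Y r)) q \<in> E'_fibre q"
    "fst (nabla_E' L X (\<lambda>r. Phi' r (Y r)) q) = pc (Y' (X q))"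
    by (rule nabla_E'_eq[of L _ q X "\<lambda>v. pc (Y' v)", OF _ q X d(2)], rule Phi_in_fibres(2)[OF L _ Y], assumption+)+
qed

lemma local_cubic_eq:
  assumes L: "legendre_submanifold L" and q: "q \<in> L"
    and X: "X q \<in> tangent_space L q"
    and Y: "\<And>r. r \<in> L \<Longrightarrow> Y r \<in> tangent_space L r" and Z: "\<And>r. r \<in> L \<Longrightarrow> Z r \<in> tangent_space L r"
    and dY: "(Y has_derivative Y') (at q within L)" and dZ: "(Z has_derivative Z') (at q within L)"
  shows "local_cubic L X Y Z q = xc (Z q) \<bullet> pc (Y' (X q)) - xc (Y' (X q)) \<bullet> pc (Z q)"
proof -
  have "local_cubic L X Y Z q = (xc (Y q) \<bullet> pc (Z' (X q)) + xc (Z q) \<bullet> pc (Y' (X q))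
      - xc (Y' (X q)) \<bullet> pc (Z q) - xc (Z' (X q)) \<bullet> pc (Y q)) / 2"
    using nabla_Phi[of L q X Y Y', OF L q X Y dY] nabla_Phi[of L q X Z Z', OF L q X Z dZ]
      Phi_in_fibres[OF L q Y[OF q]] Phi_in_fibres[OF L q Z[OF q]]
    by (simp add: local_cubic_def Let_def tau_mix_eq) (simp add: Phi_eq Phi'_eq field_simps)
  \<comment> \<open>This equates the first minus the fourth term of the numerator above with the
    second minus the third, so the sum doubles and cancels the factor 1/2.\<close>
  moreover have "xc (Y q) \<bullet> pc (Z' (X q)) + xc (Y' (X q)) \<bullet> pc (Z q) =
      xc (Z q) \<bullet> pc (Y' (X q)) + xc (Z' (X q)) \<bullet> pc (Y q)"
  proof -
    have 1: "((\<lambda>r. xc (Y r) \<bullet> pc (Z r)) has_derivative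
        (\<lambda>v. xc (Y q) \<bullet> pc (Z' v) + xc (Y' v) \<bullet> pc (Z q))) (at q within L)"
      by (intro has_derivative_inner coord_has_derivative dY dZ)
    have 2: "((\<lambda>r. xc (Z r) \<bullet> pc (Y r)) has_derivative
        (\<lambda>v. xc (Z q) \<bullet> pc (Y' v) + xc (Z' v) \<bullet> pc (Y q))) (at q within L)"
      by (intro has_derivative_inner coord_has_derivative dY dZ)
    \<comment> \<open>By symmetry of the form along \<open>L\<close>, one function has two relative
      derivatives; these need agree only on tangent vectors, hence the evaluation at
      \<open>X q\<close>.\<close>
    have "((\<lambda>r. xc (Y r) \<bullet> pc (Z r)) has_derivative
        (\<lambda>v. xc (Z q) \<bullet> pc (Y' v) + xc (Z' v) \<bullet> pc (Y q))) (at q within L)"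
      by (rule has_derivative_transform[OF q _ 2]) (rule legendre_symmetric[OF L _ Y Z])
    from dif_eq[OF 1 X] dif_eq[OF this X] show ?thesis by simp
  qed
  ultimately show ?thesis by simp
qed


section \<open>Vector fields and brackets on a quasi-Hessian manifold\<close>

locale quasi_hessian =
  fixes Q :: "('i, 'n::finite, 'm) gluing"
  assumes quasi_hessian: "quasi_hessian_manifold Q"
begin

lemma legendre_model: "\<alpha> \<in> indices Q \<Longrightarrow> legendre_submanifold (model Q \<alpha>)"
  using quasi_hessian by (simp add: quasi_hessian_manifold_def)

lemma overlap_openin:
  assumes "\<alpha> \<in> indices Q" "\<beta> \<in> indices Q"
  shows "openin (top_of_set (model Q \<alpha>)) (overlap Q \<alpha> \<beta>)"
  using quasi_hessian assms unfolding quasi_hessian_manifold_def by blast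

lemma glue_diffeomorphism:
  assumes "\<alpha> \<in> indices Q" "\<beta> \<in> indices Q"
  shows "diffeomorphism (overlap Q \<alpha> \<beta>) (overlap Q \<beta> \<alpha>) (glue Q \<alpha> \<beta>)"
  using quasi_hessian assms unfolding quasi_hessian_manifold_def by blast

lemma incl_eq_iff:
  assumes "\<alpha> \<in> indices Q" "\<beta> \<in> indices Q" "p \<in> model Q \<alpha>" "q \<in> model Q \<beta>"
  shows "incl Q \<alpha> p = incl Q \<beta> q \<longleftrightarrow> p \<in> overlap Q \<alpha> \<beta> \<and> q = glue Q \<alpha> \<beta> p"
  using quasi_hessian assms unfolding quasi_hessian_manifold_def by blast

lemma quotient_incl:
  "quotient_map (sum_topology (\<lambda>\<alpha>. top_of_set (model Q \<alpha>)) (indices Q)) (glued Q)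
     (\<lambda>(\<alpha>, p). incl Q \<alpha> p)"
  using quasi_hessian unfolding quasi_hessian_manifold_def by blast

lemma topspace_glued: "topspace (glued Q) = (\<Union>\<alpha>\<in>indices Q. incl Q \<alpha> ` model Q \<alpha>)"
  using quotient_imp_surjective_map[OF quotient_incl] by (auto simp: image_iff) force+

lemma overlap_subset: "\<alpha> \<in> indices Q \<Longrightarrow> \<beta> \<in> indices Q \<Longrightarrow> overlap Q \<alpha> \<beta> \<subseteq> model Q \<alpha>"
  using overlap_openin openin_imp_subset by blast

lemma glue_in_overlap:
  "\<alpha> \<in> indices Q \<Longrightarrow> \<beta> \<in> indices Q \<Longrightarrow> p \<in> overlap Q \<alpha> \<beta> \<Longrightarrow> glue Q \<alpha> \<beta> p \<in> overlap Q \<beta> \<alpha>"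
  using glue_diffeomorphism by (auto simp: diffeomorphism_def bij_betw_def)

lemma glue_in_model:
  "\<alpha> \<in> indices Q \<Longrightarrow> \<beta> \<in> indices Q \<Longrightarrow> p \<in> overlap Q \<alpha> \<beta> \<Longrightarrow> glue Q \<alpha> \<beta> p \<in> model Q \<beta>"
  using glue_in_overlap overlap_subset by blast

lemma incl_glue:
  assumes "\<alpha> \<in> indices Q" "\<beta> \<in> indices Q" "p \<in> overlap Q \<alpha> \<beta>"
  shows "incl Q \<beta> (glue Q \<alpha> \<beta> p) = incl Q \<alpha> p"
  using incl_eq_iff[OF assms(1,2), of p "glue Q \<alpha> \<beta> p"] glue_in_model[OF assms]
    overlap_subset[OF assms(1,2)] assms(3) by auto

text \<open>Compatibility of vector fields is stated with derivatives relative to the overlap,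
  \<open>act\<close> with derivatives relative to the model; openness of the overlap identifies the
  two.\<close>

lemma at_within_overlap:
  assumes "\<alpha> \<in> indices Q" "\<beta> \<in> indices Q" "q \<in> overlap Q \<alpha> \<beta>"
  shows "at q within overlap Q \<alpha> \<beta> = at q within model Q \<alpha>"
proof -
  obtain T where "open T" "overlap Q \<alpha> \<beta> = model Q \<alpha> \<inter> T"
    using overlap_openin[OF assms(1,2)] unfolding openin_open by blast
  then show ?thesis using assms(3) by (intro at_within_nhd[of q T]) auto
qed

lemma vector_field_tangent:
  "vector_field Q X \<Longrightarrow> \<alpha> \<in> indices Q \<Longrightarrow> q \<in> model Q \<alpha> \<Longrightarrow> X \<alpha> q \<in> tangent_space (model Q \<alpha>) q"
  by (simp add: vector_field_def)

section \<open>Differentiation of functions on the glued manifold\<close>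

lemma descend_eq:
  assumes "\<alpha> \<in> indices Q" "q \<in> model Q \<alpha>" "incl Q \<alpha> q = r"
    and "\<And>\<beta> p. \<beta> \<in> indices Q \<Longrightarrow> p \<in> model Q \<beta> \<Longrightarrow> incl Q \<beta> p = r \<Longrightarrow> f \<beta> p = t"
  shows "descend Q f r = t"
  unfolding descend_def by (rule the_equality) (use assms in blast)+

text \<open>One model suffices to compute \<open>act\<close>: in any other model the chain rule
  inserts the differential of the gluing map, which is how the vector field is transported.
  Agreement of \<open>f\<close> with \<open>g\<close> is asked only on a neighbourhood
  \<open>T\<close>, since the divergence is known only near the diagonal.\<close>

lemma act_eq:
  assumes X: "vector_field Q X" and \<alpha>: "\<alpha> \<in> indices Q" and q: "q \<in> model Q \<alpha>"
    and T: "open T" "q \<in> T" and f: "\<And>p. p \<in> model Q \<alpha> \<Longrightarrow> p \<in> T \<Longrightarrow> f (incl Q \<alpha> p) = g p"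
    and g: "(g has_derivative g') (at q within model Q \<alpha>)"
  shows "act Q X f (incl Q \<alpha> q) = g' (X \<alpha> q)"
  unfolding act_def
proof (rule descend_eq[OF \<alpha> q refl])
  have nhd: "at q within (model Q \<alpha> \<inter> T) = at q within model Q \<alpha>"
    using T by (intro at_within_nhd[of q T]) auto
  have "(g has_derivative g') (at q within (model Q \<alpha> \<inter> T))" unfolding nhd by (rule g)
  then have f': "((\<lambda>p. f (incl Q \<alpha> p)) has_derivative g') (at q within model Q \<alpha>)"
    unfolding nhd[symmetric] by (rule has_derivative_transform[rotated 2]) (use q T f in auto)
  fix \<beta> p
  assume \<beta>: "\<beta> \<in> indices Q" "p \<in> model Q \<beta>" "incl Q \<beta> p = incl Q \<alpha> q"
  then have p: "p \<in> overlap Q \<beta> \<alpha>" and pq: "q = glue Q \<beta> \<alpha> p"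
    using incl_eq_iff[of \<beta> \<alpha> p q] \<alpha> q by auto
  obtain G' where G': "(glue Q \<beta> \<alpha> has_derivative G') (at p within overlap Q \<beta> \<alpha>)"
    using glue_diffeomorphism[OF \<beta>(1) \<alpha>] p
    unfolding diffeomorphism_def by (metis smooth_on_has_derivative)
  \<comment> \<open>The gluing map lands in the model \<open>\<alpha>\<close>, so the derivative
    there restricts to its image and can be composed with \<open>G'\<close>.\<close>
  have "((\<lambda>p. f (incl Q \<alpha> p)) has_derivative g') (at (glue Q \<beta> \<alpha> p) within glue Q \<beta> \<alpha> ` overlap Q \<beta> \<alpha>)"
    by (rule has_derivative_subset[OF f'[unfolded pq]]) (use glue_in_model[OF \<beta>(1) \<alpha>] in auto)
  from has_derivative_in_compose[OF G' this]
  have "((\<lambda>p. f (incl Q \<beta> p)) has_derivative (\<lambda>v. g' (G' v))) (at p within overlap Q \<beta> \<alpha>)"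
    by (rule has_derivative_transform[OF p, rotated]) (simp add: incl_glue \<alpha> \<beta>)
  note at = at_within_overlap[OF \<beta>(1) \<alpha> p]
  note tan = vector_field_tangent[OF X \<beta>(1,2)]
  have "X \<alpha> q = dif (overlap Q \<beta> \<alpha>) (glue Q \<beta> \<alpha>) p (X \<beta> p)"
    using X \<alpha> \<beta>(1) p pq by (simp add: vector_field_def)
  also have "\<dots> = dif (model Q \<beta>) (glue Q \<beta> \<alpha>) p (X \<beta> p)" by (simp add: dif_def at)
  also have "\<dots> = G' (X \<beta> p)" by (rule dif_eq[OF G'[unfolded at] tan])
  finally have "X \<alpha> q = G' (X \<beta> p)" .
  moreover have "dif (model Q \<beta>) (\<lambda>q'. f (incl Q \<beta> q')) p (X \<beta> p) = g' (G' (X \<beta> p))"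
    by (rule dif_eq[OF _ tan]) (use \<open>((\<lambda>p. f (incl Q \<beta> p)) has_derivative _) _\<close> at in simp)
  ultimately show "dif (model Q \<beta>) (\<lambda>q'. f (incl Q \<beta> q')) p (X \<beta> p) = g' (X \<alpha> q)" by simp
qed

text \<open>In the quotient topology openness is tested in every model. The preimage in model
  \<open>\<beta>\<close> consists of the overlap points glued into \<open>A\<close>, which is open
  by continuity of the gluing map and openness of the overlap.\<close>

lemma openin_incl_image:
  assumes \<alpha>: "\<alpha> \<in> indices Q" and A: "openin (top_of_set (model Q \<alpha>)) A"
  shows "openin (glued Q) (incl Q \<alpha> ` A)"
proof -
  let ?S = "sum_topology (\<lambda>\<alpha>. top_of_set (model Q \<alpha>)) (indices Q)"
  let ?P = "{x \<in> topspace ?S. (case x of (\<beta>, p) \<Rightarrow> incl Q \<beta> p) \<in> incl Q \<alpha> ` A}"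
  have AM: "A \<subseteq> model Q \<alpha>" using openin_imp_subset[OF A] .
  have "openin (top_of_set (model Q \<beta>)) {p. (\<beta>, p) \<in> ?P}" if \<beta>: "\<beta> \<in> indices Q" for \<beta>
  proof -
    let ?g = "glue Q \<beta> \<alpha>"
    have eq: "{p. (\<beta>, p) \<in> ?P} = overlap Q \<beta> \<alpha> \<inter> ?g -` A"
    proof (intro set_eqI iffI)
      fix p assume "p \<in> {p. (\<beta>, p) \<in> ?P}"
      then obtain a where "p \<in> model Q \<beta>" "a \<in> A" "incl Q \<beta> p = incl Q \<alpha> a" by auto
      then show "p \<in> overlap Q \<beta> \<alpha> \<inter> ?g -` A"
        using incl_eq_iff[OF \<beta> \<alpha>, of p a] AM by auto
    next
      fix p assume p: "p \<in> overlap Q \<beta> \<alpha> \<inter> ?g -` A"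
      then have "p \<in> model Q \<beta>" "incl Q \<beta> p = incl Q \<alpha> (?g p)"
        using overlap_subset[OF \<beta> \<alpha>] incl_glue[OF \<beta> \<alpha>, of p] by auto
      then show "p \<in> {p. (\<beta>, p) \<in> ?P}" using p \<beta> by auto
    qed
    have "?g differentiable (at p within overlap Q \<beta> \<alpha>)" if "p \<in> overlap Q \<beta> \<alpha>" for p
      using glue_diffeomorphism[OF \<beta> \<alpha>] that unfolding diffeomorphism_def differentiable_def
      by (metis smooth_on_has_derivative)
    then have "continuous_on (overlap Q \<beta> \<alpha>) ?g"
      by (auto simp: continuous_on_eq_continuous_within intro: differentiable_imp_continuous_within)
    then have "openin (top_of_set (overlap Q \<beta> \<alpha>)) (overlap Q \<beta> \<alpha> \<inter> ?g -` A)"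
      by (rule continuous_openin_preimage[OF _ _ A]) (use glue_in_model[OF \<beta> \<alpha>] in auto)
    then show ?thesis unfolding eq
      using overlap_openin[OF \<beta> \<alpha>] openin_trans by blast
  qed
  then have "openin ?S ?P" unfolding openin_sum_topology by auto
  moreover have "incl Q \<alpha> ` A \<subseteq> topspace (glued Q)" using AM \<alpha> unfolding topspace_glued by auto
  ultimately show ?thesis using quotient_incl unfolding quotient_map_def by blast
qed

end

text \<open>Near the diagonal of the local model \<open>\<alpha>\<close>, where \<open>D\<close> is the canonical divergence, brackets are
  derivatives of \<open>z(p) + z'(q) - x(p) \<bullet> p(q)\<close>.\<close>

locale divergence_in_model = quasi_hessian Q for Q :: "('i, 'n::finite, 'm) gluing" +
  fixes D :: "'m \<times> 'm \<Rightarrow> real" and \<alpha> :: 'i and T :: "('n contact \<times> 'n contact) set"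
  assumes \<alpha>: "\<alpha> \<in> indices Q" and T: "open T"
    and diag: "\<And>q. q \<in> model Q \<alpha> \<Longrightarrow> (q, q) \<in> T"
    and D: "\<And>p q. p \<in> model Q \<alpha> \<Longrightarrow> q \<in> model Q \<alpha> \<Longrightarrow> (p, q) \<in> T \<Longrightarrow>
      D (incl Q \<alpha> p, incl Q \<alpha> q) = local_divergence p q"
begin

abbreviation "M \<equiv> model Q \<alpha>"
abbreviation "\<iota> \<equiv> incl Q \<alpha>"

lemma open_slices: "open {p. (p, q) \<in> T}" "open {q. (p, q) \<in> T}"
proof -
  have "{p. (p, q) \<in> T} = (\<lambda>p. (p, q)) -` T" "{q. (p, q) \<in> T} = (\<lambda>q. (p, q)) -` T" by auto
  then show "open {p. (p, q) \<in> T}" "open {q. (p, q) \<in> T}"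
    by (auto intro!: open_vimage T continuous_intros)
qed

lemma vector_field_derivative:
  assumes "vector_field Q X" "q \<in> M"
  obtains X' where "(X \<alpha> has_derivative X') (at q within M)"
  using assms \<alpha> unfolding vector_field_def by (metis smooth_on_has_derivative)

text \<open>On tangent vectors \<open>zc\<close> equals \<open>pc p \<bullet> xc\<close>, so the
  derivative of \<open>z(p)\<close> combines with that of \<open>x(p) \<bullet> p(q)\<close> into a
  difference of \<open>p\<close>-values, zero on the diagonal.\<close>

lemma act_fst_D:
  assumes X: "vector_field Q X" and p: "p \<in> M" and q: "q \<in> M" and pq: "(p, q) \<in> T"
  shows "act_fst Q X D (\<iota> p, \<iota> q) = (pc p - pc q) \<bullet> xc (X \<alpha> p)"
proof -
  have "act Q X (\<lambda>p'. D (p', \<iota> q)) (\<iota> p) = zc (X \<alpha> p) + 0 - xc (X \<alpha> p) \<bullet> pc q"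
  proof (rule act_eq[OF X \<alpha> p open_slices(1)[of q]])
    show "((\<lambda>p. zc p + zc' q - xc p \<bullet> pc q) has_derivative (\<lambda>v. zc v + 0 - xc v \<bullet> pc q)) (at p within M)"
      by (intro has_derivative_diff has_derivative_add coord_derivs_within has_derivative_const
          has_derivative_inner_left)
  qed (use pq D q in \<open>auto simp: local_divergence_def\<close>)
  then show ?thesis
    using legendre_zc[OF legendre_model[OF \<alpha>] p vector_field_tangent[OF X \<alpha> p]]
    by (simp add: act_fst_def inner_diff_left inner_diff_right inner_commute)
qed

lemma act_snd_D:
  assumes Y: "vector_field Q Y" and p: "p \<in> M" and q: "q \<in> M" and pq: "(p, q) \<in> T"
  shows "act_snd Q Y D (\<iota> p, \<iota> q) = (xc q - xc p) \<bullet> pc (Y \<alpha> q)"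
proof -
  \<comment> \<open>The three terms in parentheses are the differential of \<open>z'\<close>; the
    Legendre condition cancels two of them and leaves
    \<open>xc q \<bullet> pc (Y \<alpha> q)\<close>.\<close>
  have "act Q Y (\<lambda>q'. D (\<iota> p, q')) (\<iota> q) =
    0 + (pc q \<bullet> xc (Y \<alpha> q) + pc (Y \<alpha> q) \<bullet> xc q - zc (Y \<alpha> q)) - xc p \<bullet> pc (Y \<alpha> q)"
  proof (rule act_eq[OF Y \<alpha> q open_slices(2)[of p]])
    show "((\<lambda>q. zc p + (pc q \<bullet> xc q - zc q) - xc p \<bullet> pc q) has_derivative
        (\<lambda>v. 0 + (pc q \<bullet> xc v + pc v \<bullet> xc q - zc v) - xc p \<bullet> pc v)) (at q within M)"
      by (intro has_derivative_diff has_derivative_add coord_derivs_within has_derivative_const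
          has_derivative_inner has_derivative_inner_right)
  qed (use pq D p in \<open>auto simp: local_divergence_def zc'_def\<close>)
  then show ?thesis
    using legendre_zc[OF legendre_model[OF \<alpha>] q vector_field_tangent[OF Y \<alpha> q]]
    by (simp add: act_snd_def inner_diff_left inner_diff_right inner_commute)
qed

text \<open>The formula is kept at all pairs in \<open>T\<close>, not just on the diagonal, so that
  it can be differentiated once more; the open slices of \<open>T\<close> provide the neighbourhoods
  for \<open>act_eq\<close>.\<close>

lemma act_fst_act_snd_D:
  assumes X: "vector_field Q X" and Y: "vector_field Q Y"
    and p: "p \<in> M" and q: "q \<in> M" and pq: "(p, q) \<in> T"
  shows "act_fst Q X (act_snd Q Y D) (\<iota> p, \<iota> q) = - (xc (X \<alpha> p) \<bullet> pc (Y \<alpha> q))"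
proof -
  have "act Q X (\<lambda>p'. act_snd Q Y D (p', \<iota> q)) (\<iota> p) = (0 - xc (X \<alpha> p)) \<bullet> pc (Y \<alpha> q)"
  proof (rule act_eq[OF X \<alpha> p open_slices(1)[of q]])
    show "((\<lambda>p. (xc q - xc p) \<bullet> pc (Y \<alpha> q)) has_derivative (\<lambda>v. (0 - xc v) \<bullet> pc (Y \<alpha> q))) (at p within M)"
      by (intro has_derivative_inner_left has_derivative_diff coord_derivs_within has_derivative_const)
  qed (use pq act_snd_D[OF Y] q in auto)
  then show ?thesis by (simp add: act_fst_def)
qed

lemma act_fst_act_fst_act_snd_D:
  assumes X: "vector_field Q X" and Y: "vector_field Q Y" and Z: "vector_field Q Z"
    and p: "p \<in> M" and q: "q \<in> M" and pq: "(p, q) \<in> T"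
    and dY: "(Y \<alpha> has_derivative Y') (at p within M)"
  shows "act_fst Q X (act_fst Q Y (act_snd Q Z D)) (\<iota> p, \<iota> q) =
    - (xc (Y' (X \<alpha> p)) \<bullet> pc (Z \<alpha> q))"
proof -
  have "act Q X (\<lambda>p'. act_fst Q Y (act_snd Q Z D) (p', \<iota> q)) (\<iota> p) = - (xc (Y' (X \<alpha> p)) \<bullet> pc (Z \<alpha> q))"
  proof (rule act_eq[OF X \<alpha> p open_slices(1)[of q]])
    show "((\<lambda>p. - (xc (Y \<alpha> p) \<bullet> pc (Z \<alpha> q))) has_derivative (\<lambda>v. - (xc (Y' v) \<bullet> pc (Z \<alpha> q)))) (at p within M)"
      by (intro has_derivative_minus has_derivative_inner_left coord_has_derivative dY)
  qed (use pq act_fst_act_snd_D[OF Y Z] q in auto)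
  then show ?thesis by (simp add: act_fst_def)
qed

text \<open>The summand with factor \<open>xc q - xc p\<close> vanishes on the diagonal but has to
  be kept: a later derivative in the first variable acts on it.\<close>

lemma act_snd_act_snd_D:
  assumes X: "vector_field Q X" and Y: "vector_field Q Y"
    and p: "p \<in> M" and q: "q \<in> M" and pq: "(p, q) \<in> T"
    and dY: "(Y \<alpha> has_derivative Y') (at q within M)"
  shows "act_snd Q X (act_snd Q Y D) (\<iota> p, \<iota> q) =
    (xc q - xc p) \<bullet> pc (Y' (X \<alpha> q)) + xc (X \<alpha> q) \<bullet> pc (Y \<alpha> q)"
proof -
  have "act Q X (\<lambda>q'. act_snd Q Y D (\<iota> p, q')) (\<iota> q) =
    (xc q - xc p) \<bullet> pc (Y' (X \<alpha> q)) + (xc (X \<alpha> q) - 0) \<bullet> pc (Y \<alpha> q)"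
  proof (rule act_eq[OF X \<alpha> q open_slices(2)[of p]])
    show "((\<lambda>q. (xc q - xc p) \<bullet> pc (Y \<alpha> q)) has_derivative
        (\<lambda>v. (xc q - xc p) \<bullet> pc (Y' v) + (xc v - 0) \<bullet> pc (Y \<alpha> q))) (at q within M)"
      by (intro has_derivative_inner has_derivative_diff coord_derivs_within has_derivative_const
          coord_has_derivative dY)
  qed (use pq act_snd_D[OF Y] p in auto)
  then show ?thesis by (simp add: act_snd_def)
qed

text \<open>With \<open>q\<close> fixed, \<open>Y'\<close> is the same derivative for all nearby
  \<open>p\<close>, so only the factor \<open>xc q - xc p\<close> varies and the other summand is
  constant.\<close>

lemma act_fst_act_snd_act_snd_D:
  assumes X: "vector_field Q X" and Y: "vector_field Q Y" and Z: "vector_field Q Z" and q: "q \<in> M"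
    and dY: "(Y \<alpha> has_derivative Y') (at q within M)"
  shows "act_fst Q Z (act_snd Q X (act_snd Q Y D)) (\<iota> q, \<iota> q) =
    - (xc (Z \<alpha> q) \<bullet> pc (Y' (X \<alpha> q)))"
proof -
  have "act Q Z (\<lambda>p'. act_snd Q X (act_snd Q Y D) (p', \<iota> q)) (\<iota> q) =
      (0 - xc (Z \<alpha> q)) \<bullet> pc (Y' (X \<alpha> q)) + 0"
  proof (rule act_eq[OF Z \<alpha> q open_slices(1)[of q]])
    show "((\<lambda>p. (xc q - xc p) \<bullet> pc (Y' (X \<alpha> q)) + xc (X \<alpha> q) \<bullet> pc (Y \<alpha> q)) has_derivative
        (\<lambda>v. (0 - xc v) \<bullet> pc (Y' (X \<alpha> q)) + 0)) (at q within M)"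
      by (intro has_derivative_add has_derivative_inner_left has_derivative_diff coord_derivs_within
          has_derivative_const)
  qed (use diag[OF q] act_snd_act_snd_D[OF X Y _ q _ dY] in auto)
  then show ?thesis by (simp add: act_fst_def)
qed

lemma bracket_empty:
  assumes q: "q \<in> M"
  shows "bracket Q D [] [] (\<iota> q) = 0"
  using D[OF q q diag[OF q]] by (simp add: bracket_def local_divergence_def zc'_def inner_commute)

lemma brackets:
  assumes q: "q \<in> M" and X: "vector_field Q X"
  shows "bracket Q D [X] [] (\<iota> q) = 0" "bracket Q D [] [X] (\<iota> q) = 0"
    and "vector_field Q Y \<Longrightarrow> local_metric q (X \<alpha> q) (Y \<alpha> q) = - bracket Q D [X] [Y] (\<iota> q)"
    and "vector_field Q Y \<Longrightarrow> vector_field Q Z \<Longrightarrow> local_cubic M (X \<alpha>) (Y \<alpha>) (Z \<alpha>) q =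
      bracket Q D [X, Y] [Z] (\<iota> q) - bracket Q D [Z] [X, Y] (\<iota> q)"
proof -
  note dq = diag[OF q]
  show "bracket Q D [X] [] (\<iota> q) = 0" "bracket Q D [] [X] (\<iota> q) = 0"
    using act_fst_D[OF X q q dq] act_snd_D[OF X q q dq] by (simp_all add: bracket_def)
next
  assume Y: "vector_field Q Y"
  show "local_metric q (X \<alpha> q) (Y \<alpha> q) = - bracket Q D [X] [Y] (\<iota> q)"
    using local_metric_eq[OF legendre_model[OF \<alpha>] q vector_field_tangent[OF X \<alpha> q] vector_field_tangent[OF Y \<alpha> q]]
      act_fst_act_snd_D[OF X Y q q diag[OF q]] by (simp add: bracket_def)
next
  assume Y: "vector_field Q Y" and Z: "vector_field Q Z"
  obtain Y' where dY: "(Y \<alpha> has_derivative Y') (at q within M)" by (rule vector_field_derivative[OF Y q])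
  obtain Z' where dZ: "(Z \<alpha> has_derivative Z') (at q within M)" by (rule vector_field_derivative[OF Z q])
  have "local_cubic M (X \<alpha>) (Y \<alpha>) (Z \<alpha>) q =
      xc (Z \<alpha> q) \<bullet> pc (Y' (X \<alpha> q)) - xc (Y' (X \<alpha> q)) \<bullet> pc (Z \<alpha> q)"
    by (intro local_cubic_eq[where Y'=Y' and Z'=Z'] legendre_model \<alpha> q dY dZ vector_field_tangent X Y Z)
  then show "local_cubic M (X \<alpha>) (Y \<alpha>) (Z \<alpha>) q =
      bracket Q D [X, Y] [Z] (\<iota> q) - bracket Q D [Z] [X, Y] (\<iota> q)"
    \<comment> \<open>\<open>foldr\<close> lets the head of a list act last, so
      \<open>[X, Y]\<close> differentiates the field \<open>Y\<close> along \<open>X\<close> and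
      both brackets involve \<open>Y' (X \<alpha> q)\<close>, as the cubic tensor does.\<close>
    using act_fst_act_fst_act_snd_D[OF X Y Z q q diag[OF q] dY] act_fst_act_snd_act_snd_D[OF X Y Z q dY]
    by (simp add: bracket_def)
qed

end

section \<open>Smoothness of the divergence near the diagonal\<close>

lemma Ck_on_local_divergence:
  fixes f :: "'a::euclidean_space \<Rightarrow> 'n::finite contact" and g :: "'b::euclidean_space \<Rightarrow> 'n contact"
  assumes A: "open A" "Ck_on k f A" and B: "open B" "Ck_on k g B"
  shows "Ck_on k (\<lambda>x. local_divergence (f (fst x)) (g (snd x))) (A \<times> B)"
proof -
  have AB: "open (A \<times> B)" using A(1) B(1) by (rule open_Times)
  have f: "Ck_on k (\<lambda>x. f (fst x)) (A \<times> B)"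
    using Ck_on_affine[OF bounded_linear_fst AB _ A(2), of 0] by auto
  have g: "Ck_on k (\<lambda>x. g (snd x)) (A \<times> B)"
    using Ck_on_affine[OF bounded_linear_snd AB _ B(2), of 0] by auto
  show ?thesis
    unfolding local_divergence_def zc'_def
    by (intro Ck_on_add[OF AB] Ck_on_diff[OF AB] Ck_on_bounded_bilinear[OF bounded_bilinear_inner AB]
        Ck_on_bounded_linear[OF bounded_linear_coords(1) AB] Ck_on_bounded_linear[OF bounded_linear_coords(2) AB]
        Ck_on_bounded_linear[OF bounded_linear_coords(3) AB] f g)
qed

context quasi_hessian
begin

text \<open>A local smooth extension of the gluing map is restricted twice: to the open set cutting
  the overlap out of the model, and to the preimage of the prescribed target neighbourhood
  \<open>A\<close>.\<close>

lemma glue_smooth_extension: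
  assumes \<alpha>: "\<alpha> \<in> indices Q" and \<beta>: "\<beta> \<in> indices Q" and p: "p \<in> overlap Q \<beta> \<alpha>"
    and A: "open A" "glue Q \<beta> \<alpha> p \<in> A"
  obtains N g where "open N" "p \<in> N" "\<And>k. Ck_on k g N"
    "\<And>x. x \<in> N \<Longrightarrow> x \<in> model Q \<beta> \<Longrightarrow> x \<in> overlap Q \<beta> \<alpha>"
    "\<And>x. x \<in> N \<Longrightarrow> x \<in> model Q \<beta> \<Longrightarrow> g x = glue Q \<beta> \<alpha> x"
    "\<And>x. x \<in> N \<Longrightarrow> g x \<in> A"
proof -
  obtain O' where O': "open O'" "overlap Q \<beta> \<alpha> = model Q \<beta> \<inter> O'"
    using overlap_openin[OF \<beta> \<alpha>] unfolding openin_open by blast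
  have "smooth_on (overlap Q \<beta> \<alpha>) (glue Q \<beta> \<alpha>)"
    using glue_diffeomorphism[OF \<beta> \<alpha>] by (simp add: diffeomorphism_def)
  then obtain U g where U: "open U" "p \<in> U" "\<And>k. Ck_on k g U"
    "\<And>x. x \<in> U \<inter> overlap Q \<beta> \<alpha> \<Longrightarrow> g x = glue Q \<beta> \<alpha> x"
    using smooth_onE[OF _ p] by metis
  have "continuous_on (U \<inter> O') g" using U(3)[of 0] by (auto intro: continuous_on_subset)
  then have open_N: "open ((U \<inter> O') \<inter> g -` A)"
    using continuous_open_preimage U(1) O'(1) A(1) by blast
  show ?thesis
  proof (rule that[OF open_N])
    show "p \<in> (U \<inter> O') \<inter> g -` A" using U(2) U(4)[of p] p O'(2) A(2) by auto
    show "Ck_on k g ((U \<inter> O') \<inter> g -` A)" for k by (rule Ck_on_subset[OF U(3)]) auto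
  qed (use O'(2) U(4) in auto)
qed

lemma divergence_in_modelE:
  assumes "canonical_divergence Q D" "\<alpha> \<in> indices Q"
  obtains T where "divergence_in_model Q D \<alpha> T"
proof -
  obtain W where W: "openin (top_of_set (model Q \<alpha> \<times> model Q \<alpha>)) W" "\<forall>q\<in>model Q \<alpha>. (q, q) \<in> W"
    "\<forall>(p, q)\<in>W. D (incl Q \<alpha> p, incl Q \<alpha> q) = local_divergence p q"
    using assms unfolding canonical_divergence_def by blast
  then obtain T where T: "open T" "W = (model Q \<alpha> \<times> model Q \<alpha>) \<inter> T" unfolding openin_open by blast
  have "divergence_in_model Q D \<alpha> T"
    by unfold_locales (use assms(2) T W in auto)
  then show ?thesis by (rule that)
qed

text \<open>Smoothness is required with \<open>p\<close> and \<open>q\<close> in arbitrary models,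
  while \<open>D\<close> is known when both are seen in one model. Near a pair in \<open>W\<close>
  both points are moved to a common model \<open>\<alpha>\<close> by gluing maps, and
  \<open>D\<close> becomes the local divergence composed with their smooth extensions.\<close>

lemma smooth_near_diagonal_canonical_divergence:
  assumes D: "canonical_divergence Q D"
  shows "smooth_near_diagonal Q D"
proof -
  obtain T where T: "\<And>\<alpha>. \<alpha> \<in> indices Q \<Longrightarrow> divergence_in_model Q D \<alpha> (T \<alpha>)"
  proof -
    have "\<forall>\<alpha>\<in>indices Q. \<exists>T. divergence_in_model Q D \<alpha> T"
      by (intro ballI) (rule divergence_in_modelE[OF D], assumption, rule exI)
    then show thesis using that by (auto dest!: bchoice)
  qed
  \<comment> \<open>Boxes inside \<open>T \<alpha>\<close> are used because the factors have open
    images in the glued space, which makes \<open>W\<close> open in the product topology.\<close>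
  define P where "P \<alpha> A B \<longleftrightarrow> \<alpha> \<in> indices Q \<and> open A \<and> open B \<and> A \<times> B \<subseteq> T \<alpha>" for \<alpha> A B
  define W where "W = {(r, s). \<exists>\<alpha> A B. P \<alpha> A B \<and>
    r \<in> incl Q \<alpha> ` (model Q \<alpha> \<inter> A) \<and> s \<in> incl Q \<alpha> ` (model Q \<alpha> \<inter> B)}"
  have "openin (prod_topology (glued Q) (glued Q)) W"
    unfolding openin_prod_topology_alt
  proof (intro allI impI)
    fix r s assume "(r, s) \<in> W"
    then obtain \<alpha> A B where PAB: "P \<alpha> A B"
      and rs: "r \<in> incl Q \<alpha> ` (model Q \<alpha> \<inter> A)" "s \<in> incl Q \<alpha> ` (model Q \<alpha> \<inter> B)"
      unfolding W_def by blast
    have "openin (glued Q) (incl Q \<alpha> ` (model Q \<alpha> \<inter> A))" "openin (glued Q) (incl Q \<alpha> ` (model Q \<alpha> \<inter> B))"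
      using PAB by (auto simp: P_def intro!: openin_incl_image openin_open_Int)
    moreover have "incl Q \<alpha> ` (model Q \<alpha> \<inter> A) \<times> incl Q \<alpha> ` (model Q \<alpha> \<inter> B) \<subseteq> W"
      using PAB unfolding W_def by blast
    ultimately show "\<exists>U V. openin (glued Q) U \<and> openin (glued Q) V \<and> r \<in> U \<and> s \<in> V \<and> U \<times> V \<subseteq> W"
      using rs by blast
  qed
  moreover have "(r, r) \<in> W" if r: "r \<in> topspace (glued Q)" for r
  proof -
    obtain \<alpha> q where q: "\<alpha> \<in> indices Q" "q \<in> model Q \<alpha>" "r = incl Q \<alpha> q"
      using r unfolding topspace_glued by blast
    interpret divergence_in_model Q D \<alpha> "T \<alpha>" by (rule T[OF q(1)])
    obtain A B where "open A" "open B" "q \<in> A" "q \<in> B" "A \<times> B \<subseteq> T \<alpha>"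
      using open_prod_elim[OF T diag[OF q(2)]] by (metis mem_Sigma_iff)
    then show ?thesis unfolding W_def P_def using q by blast
  qed
  moreover have "smooth_on {(p, q). p \<in> model Q \<beta> \<and> q \<in> model Q \<gamma> \<and> (incl Q \<beta> p, incl Q \<gamma> q) \<in> W}
      (\<lambda>(p, q). D (incl Q \<beta> p, incl Q \<gamma> q))" (is "smooth_on ?S ?f")
    if \<beta>: "\<beta> \<in> indices Q" and \<gamma>: "\<gamma> \<in> indices Q" for \<beta> \<gamma>
    unfolding smooth_on_def
  proof (intro ballI)
    fix x assume "x \<in> ?S"
    then obtain p q where x: "x = (p, q)" and pq: "p \<in> model Q \<beta>" "q \<in> model Q \<gamma>"
      "(incl Q \<beta> p, incl Q \<gamma> q) \<in> W" by blast
    then obtain \<alpha> A B a b where PAB: "P \<alpha> A B" and a: "a \<in> model Q \<alpha>" "a \<in> A" "incl Q \<beta> p = incl Q \<alpha> a"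
      and b: "b \<in> model Q \<alpha>" "b \<in> B" "incl Q \<gamma> q = incl Q \<alpha> b"
      unfolding W_def by auto
    have \<alpha>: "\<alpha> \<in> indices Q" and AB: "open A" "open B" "A \<times> B \<subseteq> T \<alpha>" using PAB by (auto simp: P_def)
    interpret divergence_in_model Q D \<alpha> "T \<alpha>" by (rule T[OF \<alpha>])
    have p: "p \<in> overlap Q \<beta> \<alpha>" "glue Q \<beta> \<alpha> p \<in> A"
      using incl_eq_iff[OF \<beta> \<alpha> pq(1) a(1)] a by auto
    have q: "q \<in> overlap Q \<gamma> \<alpha>" "glue Q \<gamma> \<alpha> q \<in> B"
      using incl_eq_iff[OF \<gamma> \<alpha> pq(2) b(1)] b by auto
    obtain N g where N: "open N" "p \<in> N" "\<And>k. Ck_on k g N"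
      "\<And>x. x \<in> N \<Longrightarrow> x \<in> model Q \<beta> \<Longrightarrow> x \<in> overlap Q \<beta> \<alpha>"
      "\<And>x. x \<in> N \<Longrightarrow> x \<in> model Q \<beta> \<Longrightarrow> g x = glue Q \<beta> \<alpha> x" "\<And>x. x \<in> N \<Longrightarrow> g x \<in> A"
      using glue_smooth_extension[OF \<alpha> \<beta> p(1) AB(1) p(2)] by metis
    obtain N' g' where N': "open N'" "q \<in> N'" "\<And>k. Ck_on k g' N'"
      "\<And>x. x \<in> N' \<Longrightarrow> x \<in> model Q \<gamma> \<Longrightarrow> x \<in> overlap Q \<gamma> \<alpha>"
      "\<And>x. x \<in> N' \<Longrightarrow> x \<in> model Q \<gamma> \<Longrightarrow> g' x = glue Q \<gamma> \<alpha> x" "\<And>x. x \<in> N' \<Longrightarrow> g' x \<in> B"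
      using glue_smooth_extension[OF \<alpha> \<gamma> q(1) AB(2) q(2)] by metis
    let ?G = "\<lambda>x. local_divergence (g (fst x)) (g' (snd x))"
    have "\<forall>y\<in>(N \<times> N') \<inter> ?S. ?G y = ?f y"
    proof
      fix y assume "y \<in> (N \<times> N') \<inter> ?S"
      then obtain p' q' where y: "y = (p', q')" "p' \<in> N" "q' \<in> N'" "p' \<in> model Q \<beta>" "q' \<in> model Q \<gamma>"
        by blast
      have ov: "p' \<in> overlap Q \<beta> \<alpha>" "q' \<in> overlap Q \<gamma> \<alpha>" using N(4) N'(4) y by auto
      \<comment> \<open>The pair \<open>(p', q')\<close> may belong to \<open>W\<close> through a
        different box, but the extensions take values in \<open>A\<close> and \<open>B\<close>, so
        the fixed model \<open>\<alpha>\<close> serves on all of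
        \<open>N \<times> N'\<close>.\<close>
      have im: "glue Q \<beta> \<alpha> p' \<in> A" "glue Q \<gamma> \<alpha> q' \<in> B" using N(5,6) N'(5,6) y by metis+
      have "D (incl Q \<beta> p', incl Q \<gamma> q') = D (incl Q \<alpha> (glue Q \<beta> \<alpha> p'), incl Q \<alpha> (glue Q \<gamma> \<alpha> q'))"
        using incl_glue[OF \<beta> \<alpha> ov(1)] incl_glue[OF \<gamma> \<alpha> ov(2)] by simp
      also have "\<dots> = local_divergence (glue Q \<beta> \<alpha> p') (glue Q \<gamma> \<alpha> q')"
        using AB(3) im by (intro D glue_in_model \<alpha> \<beta> \<gamma> ov) auto
      finally show "?G y = ?f y" using y N(5) N'(5) by simp
    qed
    moreover have "Ck_on k ?G (N \<times> N')" for k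
      by (rule Ck_on_local_divergence[OF N(1,3) N'(1,3)])
    moreover have "open (N \<times> N')" "x \<in> N \<times> N'" using N(1,2) N'(1,2) x by (auto intro: open_Times)
    ultimately show "\<exists>U g. open U \<and> x \<in> U \<and> (\<forall>k. Ck_on k g U) \<and> (\<forall>y\<in>U \<inter> ?S. g y = ?f y)" by blast
  qed
  ultimately show ?thesis unfolding smooth_near_diagonal_def by blast
qed

section \<open>From local models to the glued manifold\<close>

lemma bracket_canonical_divergence:
  assumes D: "canonical_divergence Q D" and X: "vector_field Q X" and r: "r \<in> topspace (glued Q)"
  shows "bracket Q D [X] [] r = 0" "bracket Q D [] [X] r = 0"
    and "vector_field Q Y \<Longrightarrow> quasi_hessian_metric Q X Y r = - bracket Q D [X] [Y] r"
    and "vector_field Q Y \<Longrightarrow> vector_field Q Z \<Longrightarrow>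
      cubic_tensor Q X Y Z r = bracket Q D [X, Y] [Z] r - bracket Q D [Z] [X, Y] r"
proof -
  obtain \<alpha> q where q: "\<alpha> \<in> indices Q" "q \<in> model Q \<alpha>" "incl Q \<alpha> q = r"
    using r unfolding topspace_glued by blast
  \<comment> \<open>Every representative \<open>(\<beta>, p)\<close> of \<open>r\<close> is treated,
    because \<open>descend_eq\<close> asks for one common value; the bracket at \<open>r\<close>
    refers to no model and supplies it.\<close>
  have br: "bracket Q D [X] [] r = 0" "bracket Q D [] [X] r = 0"
    "vector_field Q Y \<Longrightarrow> local_metric p (X \<beta> p) (Y \<beta> p) = - bracket Q D [X] [Y] r"
    "vector_field Q Y \<Longrightarrow> vector_field Q Z \<Longrightarrow> local_cubic (model Q \<beta>) (X \<beta>) (Y \<beta>) (Z \<beta>) p =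
      bracket Q D [X, Y] [Z] r - bracket Q D [Z] [X, Y] r"
    if p: "\<beta> \<in> indices Q" "p \<in> model Q \<beta>" "incl Q \<beta> p = r" for \<beta> p Y Z
  proof -
    obtain T where "divergence_in_model Q D \<beta> T" using divergence_in_modelE[OF D p(1)] .
    from divergence_in_model.brackets[OF this p(2) X]
    show "bracket Q D [X] [] r = 0" "bracket Q D [] [X] r = 0"
      "vector_field Q Y \<Longrightarrow> local_metric p (X \<beta> p) (Y \<beta> p) = - bracket Q D [X] [Y] r"
      "vector_field Q Y \<Longrightarrow> vector_field Q Z \<Longrightarrow> local_cubic (model Q \<beta>) (X \<beta>) (Y \<beta>) (Z \<beta>) p =
        bracket Q D [X, Y] [Z] r - bracket Q D [Z] [X, Y] r"
      unfolding p(3) by blast+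
  qed
  show "bracket Q D [X] [] r = 0" "bracket Q D [] [X] r = 0"
    using br(1,2)[OF q] by blast+
  show "quasi_hessian_metric Q X Y r = - bracket Q D [X] [Y] r" if "vector_field Q Y"
    unfolding quasi_hessian_metric_def by (rule descend_eq[OF q br(3)[OF _ _ _ that]])
  show "cubic_tensor Q X Y Z r = bracket Q D [X, Y] [Z] r - bracket Q D [Z] [X, Y] r"
    if "vector_field Q Y" "vector_field Q Z"
    unfolding cubic_tensor_def by (rule descend_eq[OF q br(4)[OF _ _ _ that]])
qed

lemma bracket_empty_canonical_divergence:
  assumes D: "canonical_divergence Q D" and r: "r \<in> topspace (glued Q)"
  shows "bracket Q D [] [] r = 0"
proof -
  obtain \<alpha> q where q: "\<alpha> \<in> indices Q" "q \<in> model Q \<alpha>" "incl Q \<alpha> q = r"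
    using r unfolding topspace_glued by blast
  obtain T where "divergence_in_model Q D \<alpha> T" using divergence_in_modelE[OF D q(1)] .
  then show ?thesis
    using divergence_in_model.bracket_empty[of Q D \<alpha> T q] q by simp
qed

end

theorem theorem4p10:
  fixes Q :: "('i, 'n::finite, 'm) gluing" and D :: "'m \<times> 'm \<Rightarrow> real"
  assumes "quasi_hessian_manifold Q"
    and "canonical_divergence Q D"
  shows "weak_contrast_function Q D \<and>
    (\<forall>X Y. vector_field Q X \<longrightarrow> vector_field Q Y \<longrightarrow>
       (\<forall>r\<in>topspace (glued Q).
          quasi_hessian_metric Q X Y r = - bracket Q D [X] [Y] r)) \<and>
    (\<forall>X Y Z. vector_field Q X \<longrightarrow> vector_field Q Y \<longrightarrow> vector_field Q Z \<longrightarrow>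
       (\<forall>r\<in>topspace (glued Q).
          cubic_tensor Q X Y Z r = bracket Q D [X, Y] [Z] r - bracket Q D [Z] [X, Y] r))"
proof -
  interpret quasi_hessian Q by unfold_locales (rule assms(1))
  show ?thesis
    using smooth_near_diagonal_canonical_divergence[OF assms(2)]
      bracket_empty_canonical_divergence[OF assms(2)] bracket_canonical_divergence[OF assms(2)]
    unfolding weak_contrast_function_def by blast
qed

end
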